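(* Let $\mathbf{k}$ be a field such that $\mathrm{char}(\mathbf{k})\neq 2$. Any linear embedding $\mathbb{A}^3_{\mathbf{k}}\to \mathbb{P}^3_{\mathbf{k}}$ sends the Nagata automorphism $$N\colon (x,y,z)\mapsto\big(x+2y(xz-y^2)+z(xz-y^2)^2,\ y+z(xz-y^2),\ z\big)$$ of $\mathbb{A}^3_{\mathbf{k}}$ to an element of $G_3(\mathbf{k})$.
   Context: The standard involution is $\sigma_3\colon [x_0:x_1:x_2:x_3]\dashrightarrow [\frac{1}{x_0}:\frac1{x_1}:\frac1{x_2}:\frac{1}{x_3}]$, and $G_3(\mathbf{k})=\langle \sigma_3,\mathrm{Aut}(\mathbb{P}^3_{\mathbf{k}})\rangle\subset \mathrm{Bir}(\mathbb{P}^3_{\mathbf{k}})$. A linear embedding $\tau\colon\mathbb{A}^3_{\mathbf{k}}\to\mathbb{P}^3_{\mathbf{k}}$ is an open embedding such that the pull-back of a general hyperplane is a hyperplane (for example $(x,y,z)\mapsto[1:x:y:z]$). It yields an injective group homomorphism $\mathrm{Aut}(\mathbb{A}^3_{\mathbf{k}})\to \mathrm{Bir}(\mathbb{P}^3_{\mathbf{k}})$, $f\mapsto \tau f\tau^{-1}$. *)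

theory Defs
  imports
    "HOL-Library.Poly_Mapping"
    "HOL-Library.Numeral_Type"
    "HOL-Algebra.Generated_Groups"
    "HOL-Algebra.Algebraic_Closure_Type"
begin

section \<open>Polynomials in finitely many variables\<close>

text \<open>
  The variables are indexed by a finite type: by \<open>4\<close> for the homogeneous coordinates
  \<open>x\<^sub>0, x\<^sub>1, x\<^sub>2, x\<^sub>3\<close> of projective 3-space, and by \<open>3\<close> for the coordinates
  \<open>x, y, z\<close> (numbered 0, 1, 2) of affine 3-space.  Elements of the outer \<open>\<Rightarrow>\<^sub>0\<close> are the
  coefficient functions, elements of the inner one the exponent vectors.
\<close>

type_synonym ('i, 'k) mpoly = "('i \<Rightarrow>\<^sub>0 nat) \<Rightarrow>\<^sub>0 'k"

definition mvar :: "'i \<Rightarrow> ('i, 'k::comm_ring_1) mpoly" where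
  "mvar i = Poly_Mapping.single (Poly_Mapping.single i 1) 1"

definition mconst :: "'k::comm_ring_1 \<Rightarrow> ('i, 'k) mpoly" where
  "mconst c = Poly_Mapping.single 0 c"

text \<open>
  Evaluation at \<open>v\<close>, with coefficients mapped by the ring homomorphism \<open>h\<close>: substitution of
  polynomials is \<open>h = mconst\<close>, evaluation at a point over the algebraic closure is
  \<open>h = to_ac\<close>.
\<close>

definition mp_eval ::
    "('k::comm_ring_1 \<Rightarrow> 'r) \<Rightarrow> ('i::finite \<Rightarrow> 'r) \<Rightarrow> ('i, 'k) mpoly \<Rightarrow> 'r::comm_ring_1" where
  "mp_eval h v p =
     (\<Sum>m\<in>Poly_Mapping.keys p.
        h (Poly_Mapping.lookup p m) * (\<Prod>i\<in>UNIV. v i ^ Poly_Mapping.lookup m i))"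

abbreviation eval_ac ::
    "('i::finite \<Rightarrow> 'k::field alg_closure) \<Rightarrow> ('i, 'k) mpoly \<Rightarrow> 'k alg_closure" where
  "eval_ac \<equiv> mp_eval to_ac"

definition mono_degree :: "('i::finite \<Rightarrow>\<^sub>0 nat) \<Rightarrow> nat" where
  "mono_degree m = (\<Sum>i\<in>UNIV. Poly_Mapping.lookup m i)"

definition total_degree :: "('i::finite, 'k::zero) mpoly \<Rightarrow> nat" where
  "total_degree p = Max (insert 0 (mono_degree ` Poly_Mapping.keys p))"

definition homogeneous :: "nat \<Rightarrow> ('i::finite, 'k::zero) mpoly \<Rightarrow> bool" where
  "homogeneous d p \<longleftrightarrow> (\<forall>m\<in>Poly_Mapping.keys p. mono_degree m = d)"

text \<open>Composition \<open>F \<circ> G\<close> of polynomial maps given by tuples of polynomials.\<close>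

definition tuple_comp ::
    "('a \<Rightarrow> ('i::finite, 'k::comm_ring_1) mpoly) \<Rightarrow> ('i \<Rightarrow> ('j, 'k) mpoly) \<Rightarrow> 'a \<Rightarrow> ('j, 'k) mpoly" where
  "tuple_comp F G = (\<lambda>a. mp_eval mconst G (F a))"


section \<open>The group of birational maps of projective 3-space\<close>

text \<open>
  A rational map from projective 3-space to itself over the field \<open>k\<close> is
  \<open>[F\<^sub>0 : F\<^sub>1 : F\<^sub>2 : F\<^sub>3]\<close> with homogeneous polynomials of the same degree, not all zero.
  Common factors are allowed, so the map is the class of all such tuples that agree up to a
  rational factor.
\<close>

type_synonym 'k tuple4 = "4 \<Rightarrow> (4, 'k) mpoly"

definition rational_tuple :: "'k::field tuple4 \<Rightarrow> bool" where
  "rational_tuple F \<longleftrightarrow> (\<exists>d. \<forall>i. homogeneous d (F i)) \<and> (\<exists>i. F i \<noteq> 0)"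

text \<open>Equality of \<open>[F\<^sub>0 : F\<^sub>1 : F\<^sub>2 : F\<^sub>3]\<close> and \<open>[G\<^sub>0 : G\<^sub>1 : G\<^sub>2 : G\<^sub>3]\<close> for nonzero tuples.\<close>

definition proportional :: "('a \<Rightarrow> 'r::comm_ring_1) \<Rightarrow> ('a \<Rightarrow> 'r) \<Rightarrow> bool" where
  "proportional F G \<longleftrightarrow> (\<forall>i j. F i * G j = F j * G i)"

definition rat_class :: "'k::field tuple4 \<Rightarrow> 'k tuple4 set" where
  "rat_class F = {G. rational_tuple G \<and> proportional F G}"

definition birational_tuple :: "'k::field tuple4 \<Rightarrow> bool" where
  "birational_tuple F \<longleftrightarrow> rational_tuple F \<and>
     (\<exists>G. rational_tuple G \<and>
        rational_tuple (tuple_comp F G) \<and> proportional (tuple_comp F G) mvar \<and>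
        rational_tuple (tuple_comp G F) \<and> proportional (tuple_comp G F) mvar)"

definition Bir_P3 :: "'k::field tuple4 set monoid" where
  "Bir_P3 = \<lparr>carrier = rat_class ` {F. birational_tuple F},
             monoid.mult = (\<lambda>\<Phi> \<Psi>. \<Union>F\<in>\<Phi>. \<Union>G\<in>\<Psi>. rat_class (tuple_comp F G)),
             one = rat_class mvar\<rparr>"

text \<open>
  Points of projective 3-space over the algebraic closure are given by their nonzero coordinate
  vectors.  A rational map over \<open>k\<close> is a morphism iff it is defined at all of these points.
\<close>

definition everywhere_defined :: "'k::field tuple4 set \<Rightarrow> bool" where
  "everywhere_defined \<Phi> \<longleftrightarrow>
     (\<forall>p :: 4 \<Rightarrow> 'k alg_closure. p \<noteq> (\<lambda>_. 0) \<longrightarrow> (\<exists>F\<in>\<Phi>. \<exists>i. eval_ac p (F i) \<noteq> 0))"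

definition Aut_P3 :: "'k::field tuple4 set set" where
  "Aut_P3 = {\<Phi> \<in> carrier Bir_P3. everywhere_defined \<Phi> \<and>
     (\<exists>\<Psi> \<in> carrier Bir_P3. everywhere_defined \<Psi> \<and>
        \<Phi> \<otimes>\<^bsub>Bir_P3\<^esub> \<Psi> = \<one>\<^bsub>Bir_P3\<^esub> \<and> \<Psi> \<otimes>\<^bsub>Bir_P3\<^esub> \<Phi> = \<one>\<^bsub>Bir_P3\<^esub>)}"

text \<open>
  The standard involution \<open>[1/x\<^sub>0 : 1/x\<^sub>1 : 1/x\<^sub>2 : 1/x\<^sub>3]\<close>, after multiplication of all
  coordinates by \<open>x\<^sub>0 x\<^sub>1 x\<^sub>2 x\<^sub>3\<close>.
\<close>

definition sigma3 :: "'k::field tuple4" where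
  "sigma3 i = (\<Prod>j\<in>UNIV - {i}. mvar j)"

definition G3 :: "'k::field tuple4 set set" where
  "G3 = generate Bir_P3 (insert (rat_class sigma3) Aut_P3)"


section \<open>Linear embeddings of affine 3-space\<close>

text \<open>
  A morphism from affine to projective 3-space over \<open>k\<close> is
  \<open>p \<mapsto> [\<tau>\<^sub>0(p) : \<tau>\<^sub>1(p) : \<tau>\<^sub>2(p) : \<tau>\<^sub>3(p)]\<close> with polynomials \<open>\<tau>\<^sub>i\<close> over \<open>k\<close> that have no
  common zero over the algebraic closure (all line bundles on affine space are trivial).
\<close>

definition affine_morphism :: "(4 \<Rightarrow> (3, 'k::field) mpoly) \<Rightarrow> bool" where
  "affine_morphism \<tau> \<longleftrightarrow> (\<forall>p :: 3 \<Rightarrow> 'k alg_closure. \<exists>i. eval_ac p (\<tau> i) \<noteq> 0)"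

text \<open>
  Open subsets defined over \<open>k\<close> of projective 3-space, given by the cone of coordinate vectors of
  their points over the algebraic closure.
\<close>

definition open_P3 :: "(4 \<Rightarrow> 'k::field alg_closure) set \<Rightarrow> bool" where
  "open_P3 U \<longleftrightarrow> (\<exists>S :: (4, 'k) mpoly set. (\<forall>g\<in>S. \<exists>d. homogeneous d g) \<and>
     U = {p. p \<noteq> (\<lambda>_. 0) \<and> (\<exists>g\<in>S. eval_ac p g \<noteq> 0)})"

text \<open>
  Regular functions over \<open>k\<close> on such an open subset: locally quotients of homogeneous polynomials
  of the same degree.
\<close>

definition regular_on ::
    "(4 \<Rightarrow> 'k::field alg_closure) set \<Rightarrow> ((4 \<Rightarrow> 'k alg_closure) \<Rightarrow> 'k alg_closure) \<Rightarrow> bool" where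
  "regular_on U r \<longleftrightarrow> (\<forall>p\<in>U. \<exists>d a b. homogeneous d a \<and> homogeneous d b \<and> eval_ac p b \<noteq> 0 \<and>
     (\<forall>q\<in>U. eval_ac q b \<noteq> 0 \<longrightarrow> r q = eval_ac q a / eval_ac q b))"

text \<open>An open embedding is an isomorphism onto an open subset \<open>U\<close>; its inverse is \<open>\<rho>\<close>.\<close>

definition open_embedding :: "(4 \<Rightarrow> (3, 'k::field) mpoly) \<Rightarrow> bool" where
  "open_embedding \<tau> \<longleftrightarrow> affine_morphism \<tau> \<and>
     (\<exists>U (\<rho> :: 3 \<Rightarrow> (4 \<Rightarrow> 'k alg_closure) \<Rightarrow> 'k alg_closure).
        open_P3 U \<and> (\<forall>j. regular_on U (\<rho> j)) \<and>
        (\<forall>p. (\<lambda>i. eval_ac p (\<tau> i)) \<in> U \<and> (\<forall>j. \<rho> j (\<lambda>i. eval_ac p (\<tau> i)) = p j)) \<and>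
        (\<forall>q\<in>U. proportional (\<lambda>i. eval_ac (\<lambda>j. \<rho> j q) (\<tau> i)) q))"

text \<open>The pull-back of the hyperplane \<open>a\<^sub>0 x\<^sub>0 + a\<^sub>1 x\<^sub>1 + a\<^sub>2 x\<^sub>2 + a\<^sub>3 x\<^sub>3 = 0\<close>, by its equation.\<close>

definition pullback_hyperplane ::
    "(4 \<Rightarrow> (3, 'k::field) mpoly) \<Rightarrow> (4 \<Rightarrow> 'k alg_closure) \<Rightarrow> (3, 'k alg_closure) mpoly" where
  "pullback_hyperplane \<tau> a = (\<Sum>i\<in>UNIV. Poly_Mapping.map (\<lambda>c. a i * to_ac c) (\<tau> i))"

text \<open>
  A hyperplane is general if its coefficient vector lies in a suitable nonempty open subset \<open>V\<close>
  of the dual projective space.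
\<close>

definition linear_embedding :: "(4 \<Rightarrow> (3, 'k::field) mpoly) \<Rightarrow> bool" where
  "linear_embedding \<tau> \<longleftrightarrow> open_embedding \<tau> \<and>
     (\<exists>V. open_P3 V \<and> V \<noteq> {} \<and> (\<forall>a\<in>V. total_degree (pullback_hyperplane \<tau> a) = 1))"

text \<open>
  The birational map \<open>\<tau> f \<tau>\<^sup>-\<^sup>1\<close>: the class of all \<open>F\<close> for which \<open>F \<circ> \<tau>\<close> is defined and equal to
  \<open>\<tau> \<circ> f\<close>, as rational maps from affine to projective 3-space.
\<close>

definition conj_by_embedding ::
    "(4 \<Rightarrow> (3, 'k::field) mpoly) \<Rightarrow> (3 \<Rightarrow> (3, 'k) mpoly) \<Rightarrow> 'k tuple4 set" where
  "conj_by_embedding \<tau> f = {F. rational_tuple F \<and> (\<exists>i. tuple_comp F \<tau> i \<noteq> 0) \<and>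
     proportional (tuple_comp F \<tau>) (tuple_comp \<tau> f)}"

definition nagata :: "3 \<Rightarrow> (3, 'k::field) mpoly" where
  "nagata = (let x = mvar 0; y = mvar 1; z = mvar 2; D = x * z - y ^ 2 in
     (\<lambda>_. 0)(0 := x + 2 * y * D + z * D ^ 2, 1 := y + z * D, 2 := z))"

end

theory Submission
  imports Defs "HOL-Analysis.Cartesian_Space"
begin

text \<open>
  Write \<open>w, x, y, z\<close> for the homogeneous coordinates. For a suitable linear involution \<open>h\<close>, the map
  \<open>(\<sigma>\<^sub>3 h)\<^sup>3\<close> is \<open>x\<^sub>j \<mapsto> x\<^sub>i\<^sup>2 / x\<^sub>j\<close> for one pair of indices, and permutations of the coordinates
  give all pairs. Two of these maps compose to \<open>x\<^sub>a \<mapsto> x\<^sub>a x\<^sub>d\<^sup>2 / x\<^sub>e\<^sup>2\<close>, which conjugates the linear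
  map \<open>x\<^sub>a \<mapsto> x\<^sub>a + c x\<^sub>b\<close> to \<open>x\<^sub>a \<mapsto> x\<^sub>a + c x\<^sub>b x\<^sub>d\<^sup>2 / x\<^sub>e\<^sup>2\<close>.
  The Nagata automorphism is \<open>A\<^sup>-\<^sup>1 B A\<close> where \<open>A: x \<mapsto> x - y\<^sup>2 / z = x - z y\<^sup>2 / z\<^sup>2\<close> and
  \<open>B: y \<mapsto> y + x z\<^sup>2 / w\<^sup>2\<close> have this shape. A linear embedding is the standard affine chart followed
  by an element of \<open>PGL\<^sub>4(k)\<close>.
\<close>

section \<open>Substitution and homogeneity\<close>

text \<open>Every polynomial is a sum of monomials, so a statement that is compatible with addition
  needs checking for a single monomial only.\<close>

lemma poly_mapping_single_induct [case_names zero single add]: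
  fixes p :: "'a \<Rightarrow>\<^sub>0 'b::comm_monoid_add"
  assumes zero: "P 0"
    and single: "\<And>m c. P (Poly_Mapping.single m c)"
    and add: "\<And>p q. P p \<Longrightarrow> P q \<Longrightarrow> P (p + q)"
  shows "P p"
proof (induction p rule: update_induct)
  case const
  show ?case by (rule zero)
next
  case (update f a b)
  have "Poly_Mapping.update a b f = f + Poly_Mapping.single a b"
    using update.hyps
    by (intro poly_mapping_eqI) (auto simp: lookup_update lookup_add lookup_single when_def in_keys_iff)
  then show ?case
    using add[OF update.IH single] by simp
qed

text \<open>Coefficient maps, substitutions and evaluations at points are all instances, so one
  collection of rewrite rules serves all of them.\<close>

locale cring_hom =
  fixes h :: "'a::comm_ring_1 \<Rightarrow> 'b::comm_ring_1"
  assumes hom_0: "h 0 = 0"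
    and hom_1: "h 1 = 1"
    and hom_add: "h (x + y) = h x + h y"
    and hom_mult: "h (x * y) = h x * h y"
begin

lemma hom_sum: "h (sum f A) = (\<Sum>a\<in>A. h (f a))"
  by (induction A rule: infinite_finite_induct) (simp_all add: hom_0 hom_add)

lemma hom_prod: "h (prod f A) = (\<Prod>a\<in>A. h (f a))"
  by (induction A rule: infinite_finite_induct) (simp_all add: hom_1 hom_mult)

lemma hom_power: "h (x ^ n) = h x ^ n"
  by (induction n) (simp_all add: hom_1 hom_mult)

lemma hom_minus: "h (- x) = - h x"
  using hom_add[of x "- x"] by (simp add: hom_0 eq_neg_iff_add_eq_0 add.commute)

lemma hom_diff: "h (x - y) = h x - h y"
  using hom_add[of x "- y"] by (simp add: hom_minus)

lemma hom_numeral: "h (numeral n) = numeral n"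
proof -
  have "h (of_nat k) = of_nat k" for k
    by (induction k) (simp_all add: hom_0 hom_1 hom_add)
  then show ?thesis
    by (metis of_nat_numeral)
qed

lemmas hom_simps = hom_0 hom_1 hom_add hom_mult hom_sum hom_prod hom_power hom_minus hom_diff
  hom_numeral

lemma mp_eval_single:
  "mp_eval h v (Poly_Mapping.single m c) = h c * (\<Prod>i\<in>UNIV. v i ^ Poly_Mapping.lookup m i)"
  by (simp add: mp_eval_def hom_0)

lemma mp_eval_0: "mp_eval h v 0 = 0"
  by (simp add: mp_eval_def)

lemma mp_eval_add: "mp_eval h v (p + q) = mp_eval h v p + mp_eval h v q"
  unfolding mp_eval_def
  by (rule setsum_keys_plus_distrib) (simp_all add: hom_0 hom_add algebra_simps)

lemma mp_eval_mult: "mp_eval h v (p * q) = mp_eval h v p * mp_eval h v q"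
proof (induction p rule: poly_mapping_single_induct)
  case (single m c)
  show ?case
  proof (induction q rule: poly_mapping_single_induct)
    case (single n d)
    show ?case
      by (simp add: mult_single mp_eval_single hom_mult lookup_add power_add prod.distrib)
  qed (simp_all add: mp_eval_0 mp_eval_add ring_distribs)
qed (simp_all add: mp_eval_0 mp_eval_add ring_distribs)

lemma mp_eval_hom: "cring_hom (mp_eval h v)"
proof
  have "mp_eval h v (Poly_Mapping.single 0 1) = 1"
    unfolding mp_eval_single by (simp add: hom_1)
  then show "mp_eval h v 1 = 1"
    by (simp add: single_one)
qed (simp_all add: mp_eval_0 mp_eval_add mp_eval_mult)

lemma mp_eval_mconst: "mp_eval h v (mconst c) = h c"
  by (simp add: mconst_def mp_eval_single)

lemma mp_eval_mvar: "mp_eval h v (mvar i) = v i"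
proof -
  have "(\<Prod>j\<in>UNIV. v j ^ Poly_Mapping.lookup (Poly_Mapping.single i 1) j)
      = (\<Prod>j\<in>UNIV. if j = i then v i else 1)"
    by (intro prod.cong) (auto simp: lookup_single when_def)
  then show ?thesis
    by (simp add: mvar_def mp_eval_single hom_1)
qed

end

lemma cring_hom_to_ac: "cring_hom to_ac"
  by unfold_locales simp_all

interpretation mconst: cring_hom "mconst :: 'k::comm_ring_1 \<Rightarrow> ('i, 'k) mpoly"
  by unfold_locales (simp_all add: mconst_def single_one single_add mult_single)

interpretation subst: cring_hom "mp_eval mconst G :: ('i::finite, 'k::comm_ring_1) mpoly \<Rightarrow> ('j, 'k) mpoly"
  for G
  by (rule mconst.mp_eval_hom)

interpretation to_ac: cring_hom to_ac
  by (rule cring_hom_to_ac)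

interpretation eval_ac: cring_hom "eval_ac v" for v :: "'i::finite \<Rightarrow> 'k::field alg_closure"
  by (rule to_ac.mp_eval_hom)

lemma single_eq_prod_mvar:
  "Poly_Mapping.single m c = mconst c * (\<Prod>i\<in>UNIV. mvar i ^ Poly_Mapping.lookup m i)"
  for m :: "'i::finite \<Rightarrow>\<^sub>0 nat" and c :: "'k::comm_ring_1"
proof -
  have pow: "mvar i ^ n = Poly_Mapping.single (Poly_Mapping.single i n) (1 :: 'k)" for i :: 'i and n
    by (induction n) (simp_all add: mvar_def mult_single flip: single_add)
  have prod: "(\<Prod>i\<in>A. Poly_Mapping.single (f i) 1) = Poly_Mapping.single (sum f A) (1 :: 'k)"
    for f :: "'i \<Rightarrow> 'i \<Rightarrow>\<^sub>0 nat" and A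
    by (induction A rule: infinite_finite_induct) (simp_all add: mult_single)
  have "(\<Sum>i\<in>UNIV. Poly_Mapping.single i (Poly_Mapping.lookup m i)) = m"
  proof (rule poly_mapping_eqI)
    fix k
    have "Poly_Mapping.lookup (\<Sum>i\<in>UNIV. Poly_Mapping.single i (Poly_Mapping.lookup m i)) k
        = (\<Sum>i\<in>UNIV. if i = k then Poly_Mapping.lookup m k else 0)"
      unfolding lookup_sum by (intro sum.cong) (auto simp: lookup_single when_def)
    then show "Poly_Mapping.lookup (\<Sum>i\<in>UNIV. Poly_Mapping.single i (Poly_Mapping.lookup m i)) k
        = Poly_Mapping.lookup m k"
      by simp
  qed
  then show ?thesis
    by (simp add: pow prod mconst_def mult_single)
qed

lemma subst_mvar: "mp_eval mconst mvar p = p"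
proof (induction p rule: poly_mapping_single_induct)
  case (single m c)
  show ?case
    unfolding mconst.mp_eval_single by (rule single_eq_prod_mvar[symmetric])
qed (simp_all add: mconst.mp_eval_0 mconst.mp_eval_add)

text \<open>Both sides are additive in \<open>p\<close> and agree on monomials. With
  \<open>h = mconst\<close> this gives associativity of composition, with \<open>h = to_ac\<close>
  the value of a composite at a point.\<close>

lemma mp_eval_subst:
  assumes "cring_hom h"
  shows "mp_eval h v (mp_eval mconst G p) = mp_eval h (\<lambda>i. mp_eval h v (G i)) p"
proof -
  interpret cring_hom h by fact
  interpret E: cring_hom "mp_eval h v" by (rule mp_eval_hom)
  show ?thesis
    by (induction p rule: poly_mapping_single_induct)
      (simp_all add: mconst.mp_eval_0 mconst.mp_eval_add mp_eval_0 mp_eval_add E.hom_simps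
        mconst.mp_eval_single mp_eval_single mp_eval_mconst)
qed

lemma tuple_comp_assoc: "tuple_comp (tuple_comp F G) H = tuple_comp F (tuple_comp G H)"
  by (simp add: tuple_comp_def mp_eval_subst[OF mconst.cring_hom_axioms])

lemma tuple_comp_mvar_left [simp]: "tuple_comp mvar G = G"
  by (simp add: tuple_comp_def mconst.mp_eval_mvar)

lemma tuple_comp_mvar_right [simp]: "tuple_comp F mvar = F"
  by (simp add: tuple_comp_def subst_mvar)

lemma lookup_times_keys:
  assumes "m \<in> Poly_Mapping.keys (p * q)"
  obtains a b where "m = a + b" "a \<in> Poly_Mapping.keys p" "b \<in> Poly_Mapping.keys q"
  using keys_mult[of p q] assms by blast

section \<open>Homogeneous polynomials under ring operations and substitution\<close>

lemma homogeneous_0 [simp]: "homogeneous d 0"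
  by (simp add: homogeneous_def)

lemma homogeneous_add: "homogeneous d p \<Longrightarrow> homogeneous d q \<Longrightarrow> homogeneous d (p + q)"
  using keys_add[of p q] by (auto simp: homogeneous_def)

lemma homogeneous_uminus: "homogeneous d p \<Longrightarrow> homogeneous d (- p)"
  for p :: "('i::finite, 'k::ab_group_add) mpoly"
  by (simp add: homogeneous_def in_keys_iff)

lemma homogeneous_diff: "homogeneous d p \<Longrightarrow> homogeneous d q \<Longrightarrow> homogeneous d (p - q)"
  for p :: "('i::finite, 'k::ab_group_add) mpoly"
  using homogeneous_add[of d p "- q"] homogeneous_uminus[of d q] by simp

lemma homogeneous_sum: "(\<And>a. a \<in> A \<Longrightarrow> homogeneous d (f a)) \<Longrightarrow> homogeneous d (sum f A)"
  by (induction A rule: infinite_finite_induct) (auto intro: homogeneous_add)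

lemma homogeneous_mult:
  assumes "homogeneous d p" "homogeneous e q"
  shows "homogeneous (d + e) (p * q)"
  unfolding homogeneous_def
proof
  fix m
  assume "m \<in> Poly_Mapping.keys (p * q)"
  then obtain a b where "m = a + b" "a \<in> Poly_Mapping.keys p" "b \<in> Poly_Mapping.keys q"
    by (rule lookup_times_keys)
  then show "mono_degree m = d + e"
    using assms by (auto simp: homogeneous_def mono_degree_def lookup_add sum.distrib)
qed

lemma homogeneous_mconst: "homogeneous 0 (mconst c)"
  by (simp add: homogeneous_def mconst_def mono_degree_def)

lemma homogeneous_1 [simp]: "homogeneous 0 1"
  by (simp add: homogeneous_def mono_degree_def)

lemma homogeneous_mvar: "homogeneous 1 (mvar i)"
  by (simp add: homogeneous_def mvar_def mono_degree_def lookup_single when_def)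

lemma homogeneous_power: "homogeneous d p \<Longrightarrow> homogeneous (n * d) (p ^ n)"
  by (induction n) (auto intro: homogeneous_mult)

lemma homogeneous_prod:
  "finite A \<Longrightarrow> (\<And>a. a \<in> A \<Longrightarrow> homogeneous (d a) (f a)) \<Longrightarrow> homogeneous (sum d A) (prod f A)"
  by (induction A rule: finite_induct) (auto intro: homogeneous_mult)

lemma homogeneous_subst:
  assumes p: "homogeneous d p" and G: "\<And>i. homogeneous e (G i)"
  shows "homogeneous (d * e) (mp_eval mconst G p)"
  unfolding mp_eval_def
proof (rule homogeneous_sum)
  fix m
  assume m: "m \<in> Poly_Mapping.keys p"
  have "homogeneous (0 + (\<Sum>i\<in>UNIV. Poly_Mapping.lookup m i * e))
      (mconst (Poly_Mapping.lookup p m) * (\<Prod>i\<in>UNIV. G i ^ Poly_Mapping.lookup m i))"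
    by (intro homogeneous_mult homogeneous_mconst homogeneous_prod homogeneous_power G finite_class.finite_UNIV)
  moreover have "(\<Sum>i\<in>UNIV. Poly_Mapping.lookup m i * e) = d * e"
    using p m by (simp add: homogeneous_def mono_degree_def flip: sum_distrib_right)
  ultimately show "homogeneous (d * e)
      (mconst (Poly_Mapping.lookup p m) * (\<Prod>i\<in>UNIV. G i ^ Poly_Mapping.lookup m i))"
    by simp
qed

text \<open>Every monomial contributes the same factor \<open>c ^ d\<close>. Proportional tuples
  satisfy \<open>G k * G' i = G' k * G i\<close>, so this relates the values of a form at
  \<open>G\<close> and at \<open>G'\<close>.\<close>

lemma mp_eval_scale:
  assumes "homogeneous d p"
  shows "mp_eval h (\<lambda>i. c * v i) p = c ^ d * mp_eval h v p"
proof -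
  have "(\<Prod>i\<in>UNIV. (c * v i) ^ Poly_Mapping.lookup m i)
      = c ^ d * (\<Prod>i\<in>UNIV. v i ^ Poly_Mapping.lookup m i)" if "m \<in> Poly_Mapping.keys p" for m
    using assms that
    by (simp add: homogeneous_def mono_degree_def power_mult_distrib prod.distrib flip: power_sum)
  then show ?thesis
    by (simp add: mp_eval_def sum_distrib_left mult.left_commute)
qed

section \<open>Composition of birational classes\<close>

lemma proportional_refl [simp]: "proportional F F"
  by (simp add: proportional_def mult.commute)

lemma proportional_sym: "proportional F G \<Longrightarrow> proportional G F"
  by (simp add: proportional_def mult.commute)

text \<open>The zero tuple is proportional to every tuple, so the middle one must have a nonzero
  coordinate, which is then cancelled.\<close>

lemma proportional_trans:
  fixes F G H :: "'a \<Rightarrow> 'r::idom"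
  assumes "proportional F G" "proportional G H" "G k \<noteq> 0"
  shows "proportional F H"
  unfolding proportional_def
proof (intro allI)
  fix i j
  have eq: "F i * G k = F k * G i" "F j * G k = F k * G j" "G i * H j = G j * H i"
    using assms(1,2) unfolding proportional_def by auto
  have "G k * (F i * H j) = F k * (G i * H j)"
    using eq(1) by (metis mult.assoc mult.commute)
  also have "\<dots> = F k * (G j * H i)"
    by (simp only: eq(3))
  also have "\<dots> = G k * (F j * H i)"
    using eq(2) by (metis mult.assoc mult.commute)
  finally have "G k * (F i * H j) = G k * (F j * H i)" .
  then show "F i * H j = F j * H i"
    using assms(3) by simp
qed

lemma proportional_comp_left:
  assumes "proportional F F'"
  shows "proportional (tuple_comp F G) (tuple_comp F' G)"
  using assms unfolding proportional_def tuple_comp_def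
  by (metis subst.hom_mult)

lemma proportional_comp_right:
  fixes F :: "'a \<Rightarrow> ('i::finite, 'k::idom) mpoly"
    and G G' :: "'i \<Rightarrow> ('j::linorder, 'k) mpoly"
  assumes F: "\<And>i. homogeneous d (F i)" and GG': "proportional G G'"
  shows "proportional (tuple_comp F G) (tuple_comp F G')"
proof (cases "\<exists>k. G k \<noteq> 0")
  case True
  then obtain k where k: "G k \<noteq> 0"
    by blast
  have "(\<lambda>i. G k * G' i) = (\<lambda>i. G' k * G i)"
    using GG' by (auto simp: proportional_def mult.commute)
  then have eq: "G k ^ d * tuple_comp F G' i = G' k ^ d * tuple_comp F G i" for i
    unfolding tuple_comp_def by (metis F mp_eval_scale)
  have "G k ^ d * (tuple_comp F G i * tuple_comp F G' j) = G k ^ d * (tuple_comp F G j * tuple_comp F G' i)" for i j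
  proof -
    have "G k ^ d * (tuple_comp F G i * tuple_comp F G' j) = tuple_comp F G i * (G' k ^ d * tuple_comp F G j)"
      by (simp only: eq[symmetric] mult.left_commute)
    also have "\<dots> = tuple_comp F G j * (G' k ^ d * tuple_comp F G i)"
      by (simp only: mult_ac)
    also have "\<dots> = G k ^ d * (tuple_comp F G j * tuple_comp F G' i)"
      by (simp only: eq[symmetric] mult.left_commute)
    finally show ?thesis .
  qed
  then show ?thesis
    using k by (simp add: proportional_def)
next
  case False
  \<comment> \<open>The scaling argument also covers \<open>G = 0\<close>, including
    \<open>d = 0\<close>, where \<open>0 ^ d\<close> is 1.\<close>
  then have "G = (\<lambda>i. 0 * G' i)"
    by auto
  then have eq: "tuple_comp F G i = 0 ^ d * tuple_comp F G' i" for i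
    unfolding tuple_comp_def by (metis F mp_eval_scale)
  show ?thesis
    by (simp add: proportional_def eq)
qed

text \<open>That no nonzero form vanishes on the image says algebraically that the image is dense.
  Substituting such a tuple into a rational tuple never gives zero.\<close>

definition dominant :: "'k::field tuple4 \<Rightarrow> bool" where
  "dominant G \<longleftrightarrow> rational_tuple G \<and>
     (\<forall>d p. homogeneous d p \<longrightarrow> mp_eval mconst G p = 0 \<longrightarrow> p = 0)"

lemma rational_tuple_mvar: "rational_tuple mvar"
proof -
  have "(mvar 0 :: (4, 'a) mpoly) \<noteq> 0"
    by (metis keys_single keys_zero insert_not_empty mvar_def one_neq_zero)
  then show ?thesis
    unfolding rational_tuple_def using homogeneous_mvar by blast
qed

lemma rational_comp:
  assumes "rational_tuple F" "dominant G"
  shows "rational_tuple (tuple_comp F G)"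
proof -
  obtain d i where F: "\<And>i. homogeneous d (F i)" "F i \<noteq> 0"
    using assms(1) unfolding rational_tuple_def by blast
  obtain e where "\<And>i. homogeneous e (G i)"
    using assms(2) unfolding dominant_def rational_tuple_def by blast
  then have "homogeneous (d * e) (tuple_comp F G i)" for i
    unfolding tuple_comp_def by (intro homogeneous_subst F)
  moreover have "tuple_comp F G i \<noteq> 0"
    using F assms(2) unfolding tuple_comp_def dominant_def by blast
  ultimately show ?thesis
    unfolding rational_tuple_def by blast
qed

text \<open>Here \<open>G\<close> is the identity up to a factor, so the value of \<open>p\<close>
  at \<open>G\<close> is \<open>p\<close> itself up to powers of \<open>G k\<close> and
  \<open>mvar k\<close>.\<close>

lemma dominant_of_proportional_mvar:
  assumes "homogeneous d p" "mp_eval mconst G p = 0"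
    and "proportional G mvar" "rational_tuple G"
  shows "p = 0"
proof -
  obtain k where k: "G k \<noteq> 0"
    using assms(4) unfolding rational_tuple_def by blast
  have "(\<lambda>i. mvar k * G i) = (\<lambda>i. G k * mvar i)"
    using assms(3) by (auto simp: proportional_def mult.commute)
  then have "mvar k ^ d * mp_eval mconst G p = G k ^ d * mp_eval mconst mvar p"
    using mp_eval_scale[OF assms(1)] by metis
  then show ?thesis
    using k assms(2) by (simp add: subst_mvar)
qed

text \<open>A form that vanishes on \<open>G\<close> also vanishes on \<open>G\<close> composed with
  its inverse \<open>H\<close>, and that composite represents the identity.\<close>

lemma birational_dominant:
  assumes "birational_tuple G"
  shows "dominant G"
proof -
  obtain H where H: "rational_tuple (tuple_comp G H)" "proportional (tuple_comp G H) mvar"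
    and G: "rational_tuple G"
    using assms unfolding birational_tuple_def by blast
  have "p = 0" if p: "homogeneous d p" "mp_eval mconst G p = 0" for d p
  proof (rule dominant_of_proportional_mvar[OF p(1) _ H(2,1)])
    have "mp_eval mconst (tuple_comp G H) p = mp_eval mconst H (mp_eval mconst G p)"
      unfolding tuple_comp_def by (rule mp_eval_subst[OF mconst.cring_hom_axioms, symmetric])
    then show "mp_eval mconst (tuple_comp G H) p = 0"
      using p(2) by (simp add: mconst.mp_eval_0)
  qed
  with G show ?thesis
    unfolding dominant_def by blast
qed

lemma dominant_cong:
  assumes "dominant G" "proportional G G'" "rational_tuple G'"
  shows "dominant G'"
proof -
  obtain k where k: "G' k \<noteq> 0"
    using assms(3) unfolding rational_tuple_def by blast
  have "p = 0" if p: "homogeneous d p" "mp_eval mconst G' p = 0" for d p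
  proof -
    have "(\<lambda>i. G k * G' i) = (\<lambda>i. G' k * G i)"
      using assms(2) by (auto simp: proportional_def mult.commute)
    then have "G k ^ d * mp_eval mconst G' p = G' k ^ d * mp_eval mconst G p"
      using mp_eval_scale[OF p(1)] by metis
    then have "mp_eval mconst G p = 0"
      using k p(2) by simp
    then show ?thesis
      using assms(1) p(1) unfolding dominant_def by blast
  qed
  then show ?thesis
    using assms(3) unfolding dominant_def by blast
qed

lemma dominant_comp:
  assumes "dominant F" "dominant G"
  shows "dominant (tuple_comp F G)"
proof -
  have F: "rational_tuple F"
    using assms(1) unfolding dominant_def by blast
  obtain e where e: "\<And>i. homogeneous e (F i)"
    using F unfolding rational_tuple_def by blast
  have "p = 0" if p: "homogeneous d p" "mp_eval mconst (tuple_comp F G) p = 0" for d p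
  proof -
    have "mp_eval mconst G (mp_eval mconst F p) = 0"
      using p(2) unfolding tuple_comp_def by (simp add: mp_eval_subst[OF mconst.cring_hom_axioms])
    moreover have "homogeneous (d * e) (mp_eval mconst F p)"
      by (intro homogeneous_subst p e)
    ultimately show ?thesis
      using assms p(1) unfolding dominant_def by blast
  qed
  then show ?thesis
    using rational_comp[OF F assms(2)] unfolding dominant_def by blast
qed

text \<open>Naming the inverse that \<open>birational_tuple\<close> hides under a quantifier gives a
  symmetric relation, so each fact about \<open>F\<close> transfers to \<open>G\<close>.\<close>

definition birational_inverse :: "'k::field tuple4 \<Rightarrow> 'k tuple4 \<Rightarrow> bool" where
  "birational_inverse F G \<longleftrightarrow> rational_tuple F \<and> rational_tuple G \<and>
     rational_tuple (tuple_comp F G) \<and> proportional (tuple_comp F G) mvar \<and>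
     rational_tuple (tuple_comp G F) \<and> proportional (tuple_comp G F) mvar"

lemma birational_tuple_iff: "birational_tuple F \<longleftrightarrow> (\<exists>G. birational_inverse F G)"
  unfolding birational_tuple_def birational_inverse_def by blast

lemma birational_inverse_sym: "birational_inverse F G \<Longrightarrow> birational_inverse G F"
  unfolding birational_inverse_def by blast

lemma birational_inverse_dominant:
  assumes "birational_inverse F G"
  shows "dominant F" "dominant G"
  using assms birational_dominant birational_inverse_sym unfolding birational_tuple_iff by blast+

lemma birational_inverse_cong:
  assumes inv: "birational_inverse F G" and F: "proportional F F'" "rational_tuple F'"
  shows "birational_inverse F' G"
proof -
  have dom: "dominant F'" "dominant G"
    using birational_inverse_dominant[OF inv] dominant_cong F by blast+
  have G: "rational_tuple G"
    using inv unfolding birational_inverse_def by blast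
  then obtain d where d: "\<And>i. homogeneous d (G i)"
    unfolding rational_tuple_def by blast
  have rat: "rational_tuple (tuple_comp F' G)" "rational_tuple (tuple_comp G F')"
    using rational_comp dom F G by blast+
  obtain i j where ij: "tuple_comp F G i \<noteq> 0" "tuple_comp G F j \<noteq> 0"
    using inv unfolding birational_inverse_def rational_tuple_def by blast
  have FG: "proportional (tuple_comp F G) mvar" "proportional (tuple_comp G F) mvar"
    using inv unfolding birational_inverse_def by blast+
  have "proportional (tuple_comp F' G) (tuple_comp F G)"
    "proportional (tuple_comp G F') (tuple_comp G F)"
    using F(1) d by (blast intro: proportional_comp_left proportional_comp_right proportional_sym)+
  then have "proportional (tuple_comp F' G) mvar" "proportional (tuple_comp G F') mvar"
    using proportional_trans[OF _ FG(1) ij(1)] proportional_trans[OF _ FG(2) ij(2)] by blast+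
  with rat F G show ?thesis
    unfolding birational_inverse_def by blast
qed

text \<open>Associativity brings \<open>G\<close> and \<open>G'\<close> together in the middle,
  where they cancel. What remains is \<open>F\<close> composed with \<open>F'\<close>.\<close>

lemma proportional_inverse_comp:
  assumes F: "birational_inverse F F'" and G: "birational_inverse G G'"
  shows "proportional (tuple_comp (tuple_comp F G) (tuple_comp G' F')) mvar"
proof -
  obtain d i where d: "\<And>i. homogeneous d (F i)" and i: "tuple_comp F F' i \<noteq> 0"
    using F unfolding birational_inverse_def rational_tuple_def by blast
  have "proportional (tuple_comp (tuple_comp G G') F') (tuple_comp mvar F')"
    using G unfolding birational_inverse_def by (intro proportional_comp_left) blast
  then have "proportional (tuple_comp F (tuple_comp (tuple_comp G G') F')) (tuple_comp F F')"
    by (intro proportional_comp_right[OF d]) simp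
  then show ?thesis
    using F i proportional_trans[where G = "tuple_comp F F'" and k = i] unfolding tuple_comp_assoc birational_inverse_def by blast
qed

lemma birational_inverse_comp:
  assumes F: "birational_inverse F F'" and G: "birational_inverse G G'"
  shows "birational_inverse (tuple_comp F G) (tuple_comp G' F')"
proof -
  note dom = birational_inverse_dominant[OF F] birational_inverse_dominant[OF G]
  have rat: "rational_tuple (tuple_comp F G)" "rational_tuple (tuple_comp G' F')"
    using F G dom rational_comp unfolding birational_inverse_def by blast+
  have "rational_tuple (tuple_comp (tuple_comp F G) (tuple_comp G' F'))"
    "rational_tuple (tuple_comp (tuple_comp G' F') (tuple_comp F G))"
    using rat dom rational_comp dominant_comp by blast+
  moreover have "proportional (tuple_comp (tuple_comp F G) (tuple_comp G' F')) mvar"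
    by (rule proportional_inverse_comp[OF F G])
  moreover have "proportional (tuple_comp (tuple_comp G' F') (tuple_comp F G)) mvar"
    by (rule proportional_inverse_comp[OF birational_inverse_sym[OF G] birational_inverse_sym[OF F]])
  ultimately show ?thesis
    using rat unfolding birational_inverse_def by blast
qed

lemma birational_comp: "birational_tuple F \<Longrightarrow> birational_tuple G \<Longrightarrow> birational_tuple (tuple_comp F G)"
  using birational_inverse_comp unfolding birational_tuple_iff by blast

lemma birational_cong:
  "birational_tuple F \<Longrightarrow> proportional F F' \<Longrightarrow> rational_tuple F' \<Longrightarrow> birational_tuple F'"
  using birational_inverse_cong unfolding birational_tuple_iff by blast

lemma birational_rational: "birational_tuple F \<Longrightarrow> rational_tuple F"
  unfolding birational_tuple_def by blast

lemma rat_class_cong: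
  assumes "proportional F F'" "rational_tuple F" "rational_tuple F'"
  shows "rat_class F = rat_class F'"
proof -
  obtain i j where "F i \<noteq> 0" "F' j \<noteq> 0"
    using assms(2,3) unfolding rational_tuple_def by blast
  then have "proportional F G \<longleftrightarrow> proportional F' G" for G
    using proportional_trans[OF assms(1)] proportional_trans[OF proportional_sym[OF assms(1)]] by blast
  then show ?thesis
    unfolding rat_class_def by simp
qed

text \<open>The product in \<open>Bir_P3\<close> is a union over all pairs of representatives.
  Birationality of \<open>G\<close> makes its representatives dominant, so all composites are
  rational tuples and have the same class.\<close>

lemma rat_class_mult:
  assumes F: "rational_tuple F" and G: "birational_tuple G"
  shows "rat_class F \<otimes>\<^bsub>Bir_P3\<^esub> rat_class G = rat_class (tuple_comp F G)"
proof -
  have "rat_class (tuple_comp F' G') = rat_class (tuple_comp F G)"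
    if F': "F' \<in> rat_class F" and G': "G' \<in> rat_class G" for F' G'
  proof -
    have rat: "rational_tuple F'" "rational_tuple G'"
      and FG: "proportional F F'" "proportional G G'"
      using F' G' unfolding rat_class_def by blast+
    have dom: "dominant G" "dominant G'"
      using birational_dominant[OF G] dominant_cong FG rat by blast+
    obtain d where d: "\<And>i. homogeneous d (F' i)"
      using rat unfolding rational_tuple_def by blast
    have "rat_class (tuple_comp F G) = rat_class (tuple_comp F' G)"
      using FG rat dom F by (intro rat_class_cong proportional_comp_left rational_comp)
    also have "\<dots> = rat_class (tuple_comp F' G')"
      using FG rat dom d by (intro rat_class_cong proportional_comp_right rational_comp)
    finally show ?thesis ..
  qed
  then have "(\<Union>F'\<in>rat_class F. \<Union>G'\<in>rat_class G. rat_class (tuple_comp F' G'))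
      = (\<Union>F'\<in>rat_class F. \<Union>G'\<in>rat_class G. rat_class (tuple_comp F G))"
    by (intro SUP_cong refl)
  moreover have "rat_class F \<noteq> {}" "rat_class G \<noteq> {}"
    using F birational_rational[OF G] proportional_refl unfolding rat_class_def by blast+
  ultimately show ?thesis
    by (simp add: Bir_P3_def)
qed

text \<open>Birationality is kept beside membership because \<open>rat_class_mult\<close> asks for
  it.\<close>

definition in_G3 :: "'k::field tuple4 \<Rightarrow> bool" where
  "in_G3 F \<longleftrightarrow> birational_tuple F \<and> rat_class F \<in> G3"

lemma in_G3_comp:
  assumes "in_G3 F" "in_G3 G"
  shows "in_G3 (tuple_comp F G)"
proof -
  have "rat_class F \<otimes>\<^bsub>Bir_P3\<^esub> rat_class G \<in> G3"
    using assms unfolding in_G3_def G3_def by (auto intro: generate.eng)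
  then show ?thesis
    using assms birational_comp rat_class_mult birational_rational unfolding in_G3_def by metis
qed

lemma in_G3_cong:
  assumes "in_G3 F" "proportional F F'" "rational_tuple F'"
  shows "in_G3 F'"
  using assms birational_cong rat_class_cong birational_rational unfolding in_G3_def by metis

section \<open>The Nagata automorphism of projective space\<close>

text \<open>
  Equations between numerals of type \<open>4\<close> are decided by the simplifier through \<open>CARD(4)\<close>, which
  mentions \<open>UNIV\<close>. Hence \<open>UNIV_4_eq\<close> and \<open>UNIV_3_eq\<close> loop as simplification rules.
\<close>

lemma UNIV_4_eq: "(UNIV :: 4 set) = {0, 1, 2, 3}"
proof -
  \<comment> \<open>\<open>exhaust_4\<close> lists the elements as 1, 2, 3, 4.\<close>
  have "(4 :: 4) = 0"
    by simp
  then have "k \<in> {0, 1, 2, 3}" for k :: 4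
    using exhaust_4[of k] by (metis insertI1 insertI2)
  then show ?thesis
    by blast
qed

lemma UNIV_3_eq: "(UNIV :: 3 set) = {0, 1, 2}"
proof -
  have "(3 :: 3) = 0"
    by simp
  then have "k \<in> {0, 1, 2}" for k :: 3
    using exhaust_3[of k] by (metis insertI1 insertI2)
  then show ?thesis
    by blast
qed

lemma sum_UNIV_4: "(\<Sum>j\<in>UNIV. f j) = f 0 + f 1 + f 2 + f (3 :: 4)"
  unfolding UNIV_4_eq by (simp add: add.assoc)

lemma prod_UNIV_4: "(\<Prod>j\<in>UNIV. f j) = f 0 * f 1 * f 2 * f (3 :: 4)"
  unfolding UNIV_4_eq by (simp add: mult.assoc)

lemma sum_UNIV_3: "(\<Sum>j\<in>UNIV. f j) = f 0 + f 1 + f (2 :: 3)"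
  unfolding UNIV_3_eq by (simp add: add.assoc)

lemma all_4_iff: "(\<forall>k::4. P k) \<longleftrightarrow> P 0 \<and> P 1 \<and> P 2 \<and> P 3"
  using UNIV_4_eq by (metis UNIV_I empty_iff insert_iff)

lemma tuple4_eqI:
  fixes F G :: "4 \<Rightarrow> 'b"
  assumes "F 0 = G 0" "F 1 = G 1" "F 2 = G 2" "F 3 = G 3"
  shows "F = G"
  using assms all_4_iff[of "\<lambda>k. F k = G k"] by auto

text \<open>The degree is a variable with a side condition, so the rule unifies with goals whose
  degree is a numeral.\<close>

lemma homogeneous_mult':
  "homogeneous d p \<Longrightarrow> homogeneous e q \<Longrightarrow> n = d + e \<Longrightarrow> homogeneous n (p * q)"
  by (simp add: homogeneous_mult)

lemma homogeneous_power':
  "homogeneous d p \<Longrightarrow> n = k * d \<Longrightarrow> homogeneous n (p ^ k)"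
  by (simp add: homogeneous_power)

lemma homogeneous_mvar': "n = 1 \<Longrightarrow> homogeneous n (mvar i)"
  using homogeneous_mvar by blast

lemma homogeneous_mconst': "n = 0 \<Longrightarrow> homogeneous n (mconst c)"
  by (simp add: homogeneous_mconst)

lemmas homogeneous_intros = homogeneous_diff homogeneous_add homogeneous_mult' homogeneous_power'
  homogeneous_mvar' homogeneous_mconst'

lemmas comp_simps = tuple_comp_def subst.hom_simps mconst.mp_eval_mvar mconst.mp_eval_mconst

text \<open>A linear map with a linear inverse has no base points. It and its inverse are then
  everywhere defined, which puts the class into \<open>Aut_P3\<close>.\<close>

lemma linear_in_G3:
  assumes F: "\<And>i. homogeneous 1 (F i)" and G: "\<And>i. homogeneous 1 (G i)"
    and FG: "tuple_comp F G = mvar" and GF: "tuple_comp G F = mvar"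
  shows "in_G3 F"
proof -
  have nz: "\<exists>i. H i \<noteq> 0" if "tuple_comp H K = mvar" for H K :: "'a tuple4"
  proof (rule ccontr)
    assume "\<not> (\<exists>i. H i \<noteq> 0)"
    then have "tuple_comp H K i = 0" for i
      by (simp add: tuple_comp_def subst.hom_0)
    with that show False
      using rational_tuple_mvar unfolding rational_tuple_def by metis
  qed
  have rat: "rational_tuple F" "rational_tuple G"
    using F G nz FG GF unfolding rational_tuple_def by blast+
  have inv: "birational_inverse F G"
    using rat FG GF rational_tuple_mvar unfolding birational_inverse_def by simp
  \<comment> \<open>If all \<open>H i\<close> vanished at \<open>p\<close>, then \<open>p\<close>,
    the value of \<open>K\<close> at \<open>H(p)\<close>, would be the value of linear forms at 0,
    hence 0.\<close>
  have defined: "everywhere_defined (rat_class H)"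
    if "\<And>i. homogeneous 1 (K i)" "rational_tuple H" "tuple_comp K H = mvar" for H K :: "'a tuple4"
    unfolding everywhere_defined_def
  proof (intro allI impI)
    fix p :: "4 \<Rightarrow> 'a alg_closure"
    assume p: "p \<noteq> (\<lambda>_. 0)"
    have "p i = eval_ac (\<lambda>j. eval_ac p (H j)) (K i)" for i
      using fun_cong[OF that(3), of i] mp_eval_subst[OF cring_hom_to_ac, of p H "K i"]
      by (simp add: tuple_comp_def to_ac.mp_eval_mvar)
    moreover have "eval_ac (\<lambda>_. 0) (K i) = 0" for i
      using mp_eval_scale[OF that(1), of to_ac 0 "\<lambda>_. 0" i] by simp
    ultimately have "\<exists>i. eval_ac p (H i) \<noteq> 0"
      using p by (metis ext)
    then show "\<exists>F\<in>rat_class H. \<exists>i. eval_ac p (F i) \<noteq> 0"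
      using that(2) unfolding rat_class_def by auto
  qed
  have bir: "birational_tuple F" "birational_tuple G"
    using inv birational_inverse_sym birational_tuple_iff by blast+
  then have "rat_class F \<otimes>\<^bsub>Bir_P3\<^esub> rat_class G = \<one>\<^bsub>Bir_P3\<^esub>" "rat_class G \<otimes>\<^bsub>Bir_P3\<^esub> rat_class F = \<one>\<^bsub>Bir_P3\<^esub>"
    by (simp_all add: rat_class_mult rat FG GF, simp_all add: Bir_P3_def)
  moreover have "rat_class F \<in> carrier Bir_P3" "rat_class G \<in> carrier Bir_P3"
    using bir by (auto simp: Bir_P3_def)
  ultimately have "rat_class F \<in> Aut_P3"
    using defined[OF G rat(1) GF] defined[OF F rat(2) FG] unfolding Aut_P3_def by blast
  with bir show ?thesis
    unfolding in_G3_def G3_def by (blast intro: generate.incl)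
qed

text \<open>Composites of tuples carry common factors. Cancelling one keeps the class, and a nonzero
  coordinate of \<open>G\<close> forces one of \<open>F\<close>.\<close>

lemma in_G3_cancel:
  assumes "in_G3 G" "\<And>k. G k = c * F k" "\<And>k. homogeneous d (F k)"
  shows "in_G3 F"
proof (rule in_G3_cong[OF assms(1)])
  show "proportional G F"
    unfolding proportional_def assms(2) by (simp add: mult_ac)
  obtain k where "G k \<noteq> 0"
    using assms(1) unfolding in_G3_def birational_tuple_def rational_tuple_def by blast
  then show "rational_tuple F"
    using assms(2,3) unfolding rational_tuple_def by (metis mult_zero_right)
qed

section \<open>The standard involution and composition with it\<close>

lemma comp_sigma3: "tuple_comp sigma3 H i = (\<Prod>j\<in>UNIV - {i}. H j)"
  by (simp add: comp_simps sigma3_def)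

lemma homogeneous_sigma3: "homogeneous 3 (sigma3 i)"
proof -
  have "homogeneous (\<Sum>j\<in>UNIV - {i}. 1) (\<Prod>j\<in>UNIV - {i}. mvar j :: (4, 'k::field) mpoly)"
    by (intro homogeneous_prod homogeneous_mvar) simp
  then show ?thesis
    by (simp add: sigma3_def)
qed

text \<open>Coordinate \<open>i\<close> of \<open>tuple_comp sigma3 H\<close> times
  \<open>H i\<close> is the product of all coordinates, and \<open>H i * K i\<close> does not depend
  on \<open>i\<close> either. Up to a common factor, both tuples are the coordinatewise inverse of
  \<open>H\<close>.\<close>

lemma proportional_sigma3:
  fixes H K :: "'k::field tuple4"
  assumes H: "\<And>i. H i \<noteq> 0" and HK: "\<And>i j. H i * K i = H j * K j"
  shows "proportional (tuple_comp sigma3 H) K"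
  unfolding proportional_def
proof (intro allI)
  fix i j
  have prod: "tuple_comp sigma3 H i * H i = prod H UNIV" for i
    unfolding comp_sigma3 by (simp add: prod.remove[of UNIV i] mult.commute)
  have "(H i * H j) * (tuple_comp sigma3 H i * K j) = (tuple_comp sigma3 H i * H i) * (H j * K j)"
    by (simp only: mult_ac)
  also have "\<dots> = (tuple_comp sigma3 H j * H j) * (H i * K i)"
    by (simp only: prod HK[of i j])
  also have "\<dots> = (H i * H j) * (tuple_comp sigma3 H j * K i)"
    by (simp only: mult_ac)
  finally show "tuple_comp sigma3 H i * K j = tuple_comp sigma3 H j * K i"
    using H by simp
qed

lemma mvar_neq_0 [simp]: "mvar i \<noteq> 0"
  by (metis keys_single keys_zero insert_not_empty mvar_def one_neq_zero)

lemma sigma3_neq_0: "sigma3 i \<noteq> 0"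
  by (simp add: sigma3_def)

lemma rational_sigma3: "rational_tuple sigma3"
  unfolding rational_tuple_def using homogeneous_sigma3 sigma3_neq_0 by blast

lemma in_G3_sigma3: "in_G3 sigma3"
proof -
  have "sigma3 i * mvar i = (\<Prod>j\<in>UNIV. mvar j :: (4, 'a) mpoly)" for i
    by (simp add: sigma3_def prod.remove[of UNIV i] mult.commute)
  then have ss: "proportional (tuple_comp sigma3 sigma3) (mvar :: 'a tuple4)"
    by (intro proportional_sigma3 sigma3_neq_0) simp
  have "tuple_comp sigma3 sigma3 i \<noteq> (0 :: (4, 'a) mpoly)" for i
    by (simp add: comp_sigma3 sigma3_neq_0)
  moreover have "homogeneous (3 * 3) (tuple_comp sigma3 sigma3 i :: (4, 'a) mpoly)" for i
    unfolding tuple_comp_def by (intro homogeneous_subst homogeneous_sigma3)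
  ultimately have "rational_tuple (tuple_comp sigma3 (sigma3 :: 'a tuple4))"
    unfolding rational_tuple_def by blast
  then have "birational_tuple (sigma3 :: 'a tuple4)"
    using ss rational_sigma3 unfolding birational_tuple_def by blast
  then show ?thesis
    unfolding in_G3_def G3_def by (blast intro: generate.incl)
qed

text \<open>Composites with \<open>sigma3\<close> have large degree. The products
  \<open>H i * K i\<close> suffice to identify them with a reduced tuple \<open>K\<close>.\<close>

lemma in_G3_sigma3_comp:
  assumes "in_G3 H" "\<And>i. H i \<noteq> 0" "\<And>i j. H i * K i = H j * K j" "\<And>i. homogeneous d (K i)" "K k \<noteq> 0"
  shows "in_G3 K"
proof (rule in_G3_cong[OF in_G3_comp[OF in_G3_sigma3 assms(1)]])
  show "proportional (tuple_comp sigma3 H) K"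
    by (intro proportional_sigma3 assms)
  show "rational_tuple K"
    using assms(4,5) unfolding rational_tuple_def by blast
qed

section \<open>Permutations and monomial maps\<close>

definition permute :: "(4 \<Rightarrow> 4) \<Rightarrow> 'k::field tuple4" where
  "permute \<pi> = (\<lambda>k. mvar (\<pi> k))"

lemma in_G3_permute:
  assumes "bij \<pi>"
  shows "in_G3 (permute \<pi>)"
proof (rule linear_in_G3[where G = "permute (inv_into UNIV \<pi>)"])
  show "tuple_comp (permute \<pi>) (permute (inv_into UNIV \<pi>)) = mvar" "tuple_comp (permute (inv_into UNIV \<pi>)) (permute \<pi>) = mvar"
    using assms by (simp_all add: comp_simps permute_def bij_is_surj surj_f_inv_f bij_is_inj)
qed (simp_all add: permute_def homogeneous_mvar flip: One_nat_def)

text \<open>The map \<open>x\<^sub>j \<mapsto> x\<^sub>i\<^sup>2 / x\<^sub>j\<close>.\<close>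

definition flip_coord :: "4 \<Rightarrow> 4 \<Rightarrow> 'k::field tuple4" where
  "flip_coord i j = (\<lambda>k. if k = j then mvar i ^ 2 else mvar k * mvar j)"

lemma homogeneous_flip_coord: "homogeneous 2 (flip_coord i j k)"
  by (auto simp: flip_coord_def intro!: homogeneous_intros)

lemma mvar_eq_iff [simp]: "mvar i = (mvar j :: ('i, 'k::comm_ring_1) mpoly) \<longleftrightarrow> i = j"
  unfolding mvar_def by (metis (no_types) keys_single singleton_inject one_neq_zero zero_neq_one)

text \<open>
  On the projective line, the map \<open>t \<mapsto> 1 / (1 - t)\<close> has order 3. So with the linear map \<open>h\<close> that sends
  \<open>x\<^sub>1, x\<^sub>2\<close> to \<open>x\<^sub>0 - x\<^sub>1, x\<^sub>0 - x\<^sub>2\<close>, the map \<open>(\<sigma> h)\<^sup>3\<close> fixes \<open>x\<^sub>1 / x\<^sub>0\<close> and \<open>x\<^sub>2 / x\<^sub>0\<close>, while it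
  inverts \<open>x\<^sub>3 / x\<^sub>0\<close>.
\<close>

lemma in_G3_flip_coord_0_3: "in_G3 (flip_coord 0 3 :: 'k::field tuple4)"
proof -
  define h :: "'k tuple4" where
    "h = (\<lambda>k. if k = 1 \<or> k = 2 then mvar 0 - mvar k else mvar k)"
  define x :: "4 \<Rightarrow> (4, 'k) mpoly" where "x = mvar"
  have x: "homogeneous n (x k)" if "n = 1" for n k
    unfolding x_def that by (rule homogeneous_mvar)
  have x_neq [simp]: "x k \<noteq> 0" "x 0 \<noteq> x 1" "x 0 \<noteq> x 2" "x 1 \<noteq> x 0" "x 2 \<noteq> x 0" for k
    by (simp_all add: x_def)
  have h: "in_G3 h"
  proof (rule linear_in_G3[where G = h])
    show "homogeneous 1 (h k)" for k
      unfolding h_def by (auto intro!: homogeneous_intros)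
    show "tuple_comp h h = mvar"
      by (auto simp: comp_simps h_def fun_eq_iff)
    then show "tuple_comp h h = mvar" .
  qed (auto simp: h_def intro!: homogeneous_intros)
  have comp_h: "tuple_comp h F k = (if k = 1 \<or> k = 2 then F 0 - F k else F k)" for F :: "'k tuple4" and k
    by (simp add: comp_simps h_def)
  \<comment> \<open>This is \<open>[1/x0 : 1/(x0-x1) : 1/(x0-x2) : 1/x3]\<close>, the composite of
    the involution with \<open>h\<close>, times the product of the denominators.\<close>
  define P :: "'k tuple4" where
    "P = (\<lambda>_. 0)(0 := (x 0 - x 1) * (x 0 - x 2) * x 3, 1 := x 0 * (x 0 - x 2) * x 3,
      2 := x 0 * (x 0 - x 1) * x 3, 3 := x 0 * (x 0 - x 1) * (x 0 - x 2))"
  \<comment> \<open>The second iterate without common factors: each coordinate of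
    \<open>tuple_comp h P\<close> times that of \<open>Q\<close> is
    \<open>x 0 * x 1 * x 2 * x 3 * (x 0 - x 1) * (x 0 - x 2)\<close>.\<close>
  define Q :: "'k tuple4" where
    "Q = (\<lambda>_. 0)(0 := x 0 * x 1 * x 2, 1 := x 0 * (x 1 - x 0) * x 2,
      2 := x 0 * x 1 * (x 2 - x 0), 3 := x 1 * x 2 * x 3)"
  have P: "in_G3 P"
  proof (rule in_G3_sigma3_comp[OF h, where d = 3])
    have "\<forall>i. h i \<noteq> 0" "\<forall>i. \<forall>j. h i * P i = h j * P j" "\<forall>i. homogeneous 3 (P i)"
      unfolding all_4_iff
      by (auto simp: h_def P_def x_def[symmetric] algebra_simps intro!: homogeneous_intros x)
    then show "h i \<noteq> 0" "h i * P i = h j * P j" "homogeneous 3 (P i)" for i j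
      by auto
    show "P 0 \<noteq> 0"
      by (simp add: P_def)
  qed
  have Q: "in_G3 Q"
  proof (rule in_G3_sigma3_comp[OF in_G3_comp[OF h P], where d = 3])
    have hP: "tuple_comp h P = (\<lambda>_. 0)(0 := (x 0 - x 1) * (x 0 - x 2) * x 3, 1 := - x 1 * (x 0 - x 2) * x 3,
      2 := - x 2 * (x 0 - x 1) * x 3, 3 := x 0 * (x 0 - x 1) * (x 0 - x 2))"
      by (rule tuple4_eqI) (simp_all add: comp_h P_def algebra_simps)
    have "\<forall>i. tuple_comp h P i \<noteq> 0"
      unfolding all_4_iff hP by simp
    moreover have "\<forall>i. \<forall>j. tuple_comp h P i * Q i = tuple_comp h P j * Q j" "\<forall>i. homogeneous 3 (Q i)"
      unfolding all_4_iff hP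
      by (auto simp: Q_def algebra_simps intro!: homogeneous_intros x)
    ultimately show "tuple_comp h P i \<noteq> 0" "tuple_comp h P i * Q i = tuple_comp h P j * Q j" "homogeneous 3 (Q i)" for i j
      by auto
    show "Q 0 \<noteq> 0"
      by (simp add: Q_def)
  qed
  show ?thesis
  proof (rule in_G3_sigma3_comp[OF in_G3_comp[OF h Q], where d = 2])
    let ?R = "flip_coord 0 3 :: 'k tuple4"
    have hQ: "tuple_comp h Q = (\<lambda>_. 0)(0 := x 0 * x 1 * x 2, 1 := x 0 * x 0 * x 2,
      2 := x 0 * x 0 * x 1, 3 := x 1 * x 2 * x 3)"
      by (rule tuple4_eqI) (simp_all add: comp_h Q_def algebra_simps)
    \<comment> \<open>All these products equal \<open>x 0 ^ 2 * x 1 * x 2 * x 3\<close>.\<close>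
    have "\<forall>i. tuple_comp h Q i \<noteq> 0" "\<forall>i. \<forall>j. tuple_comp h Q i * ?R i = tuple_comp h Q j * ?R j"
      unfolding all_4_iff hQ
      by (auto simp: flip_coord_def x_def[symmetric] algebra_simps power2_eq_square)
    then show "tuple_comp h Q i \<noteq> 0" "tuple_comp h Q i * ?R i = tuple_comp h Q j * ?R j" for i j
      by auto
    show "?R 3 \<noteq> 0"
      by (simp add: flip_coord_def)
  qed (rule homogeneous_flip_coord)
qed

text \<open>Conjugation by a permutation that takes 0 to \<open>i\<close> and 3 to \<open>j\<close>
  reduces this to the pair 0, 3.\<close>

lemma in_G3_flip_coord:
  assumes "i \<noteq> j"
  shows "in_G3 (flip_coord i j :: 'k::field tuple4)"
proof -
  let ?\<tau> = "Transposition.transpose 0 i"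
  \<comment> \<open>The first transposition takes 0 to \<open>i\<close>. The second moves the image
    of 3 to \<open>j\<close> and fixes \<open>i\<close>, which differs from both of its
    entries.\<close>
  define \<rho> where "\<rho> = Transposition.transpose (?\<tau> 3) j \<circ> ?\<tau>"
  have bij: "bij \<rho>"
    unfolding \<rho>_def by (intro bij_comp) simp_all
  have "?\<tau> 3 \<noteq> ?\<tau> 0"
    by (simp only: transpose_eq_iff) simp
  then have \<rho>: "\<rho> 0 = i" "\<rho> 3 = j"
    using assms by (auto simp: \<rho>_def transpose_def split: if_splits)
  have inv: "inv_into UNIV \<rho> k = 3 \<longleftrightarrow> k = j" "\<rho> (inv_into UNIV \<rho> k) = k" for k
    using bij \<rho>(2) by (metis bij_inv_eq_iff, simp add: bij_is_surj surj_f_inv_f)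
  have "tuple_comp (permute (inv_into UNIV \<rho>)) (tuple_comp (flip_coord 0 3) (permute \<rho>)) = (flip_coord i j :: 'k tuple4)"
    by (auto simp: comp_simps permute_def flip_coord_def fun_eq_iff inv \<rho>)
  then show ?thesis
    using in_G3_comp[OF in_G3_permute in_G3_comp[OF in_G3_flip_coord_0_3 in_G3_permute[OF bij]], of "inv_into UNIV \<rho>"] bij
    by (metis bij_imp_bij_inv)
qed

text \<open>The map \<open>x\<^sub>a \<mapsto> x\<^sub>a x\<^sub>d\<^sup>2 / x\<^sub>e\<^sup>2\<close>.\<close>

definition scale_coord :: "4 \<Rightarrow> 4 \<Rightarrow> 4 \<Rightarrow> 'k::field tuple4" where
  "scale_coord a d e = (\<lambda>k. mvar k * (if k = a then mvar d ^ 2 else mvar e ^ 2))"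

text \<open>Inverting \<open>x_a\<close> against \<open>x_e\<close> and then against
  \<open>x_d\<close> restores \<open>x_a\<close> up to the factor
  \<open>x_d^2 / x_e^2\<close>.\<close>

lemma in_G3_scale_coord:
  assumes "d \<noteq> a" "e \<noteq> a"
  shows "in_G3 (scale_coord a d e :: 'k::field tuple4)"
proof (rule in_G3_cancel[OF in_G3_comp[OF in_G3_flip_coord[OF assms(1)] in_G3_flip_coord[OF assms(2)]]])
  show "tuple_comp (flip_coord d a) (flip_coord e a) k = mvar a * scale_coord a d e k" for k
    using assms by (auto simp: comp_simps flip_coord_def scale_coord_def algebra_simps power2_eq_square)
  show "homogeneous 3 (scale_coord a d e k)" for k
    by (auto simp: scale_coord_def intro!: homogeneous_intros)
qed

text \<open>The map \<open>x\<^sub>a \<mapsto> x\<^sub>a + c x\<^sub>b x\<^sub>d\<^sup>2 / x\<^sub>e\<^sup>2\<close>.\<close>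

definition shear :: "'k::field \<Rightarrow> 4 \<Rightarrow> 4 \<Rightarrow> 4 \<Rightarrow> 4 \<Rightarrow> 'k tuple4" where
  "shear c a b d e =
     (\<lambda>k. if k = a then mvar a * mvar e ^ 2 + mconst c * mvar b * mvar d ^ 2 else mvar k * mvar e ^ 2)"

lemma comp_shear:
  "tuple_comp (shear c a b d e) G k =
     (if k = a then G a * G e ^ 2 + mconst c * G b * G d ^ 2 else G k * G e ^ 2)"
  by (simp add: comp_simps shear_def)

lemma homogeneous_shear: "homogeneous 3 (shear c a b d e k)"
  by (auto simp: shear_def intro!: homogeneous_intros)

lemma in_G3_shear:
  assumes "a \<noteq> b" "a \<noteq> d" "a \<noteq> e"
  shows "in_G3 (shear c a b d e :: 'k::field tuple4)"
proof -
  define T :: "'k \<Rightarrow> 'k tuple4" where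
    "T c = (\<lambda>k. if k = a then mvar a + mconst c * mvar b else mvar k)" for c
  have T: "in_G3 (T c)"
  proof (rule linear_in_G3[where G = "T (- c)"])
    show "homogeneous 1 (T c k)" for c k
      by (auto simp: T_def intro!: homogeneous_intros)
    then show "homogeneous 1 (T (- c) k)" for k .
    show "tuple_comp (T c) (T (- c)) = mvar" "tuple_comp (T (- c)) (T c) = mvar"
      using assms by (auto simp: comp_simps T_def mconst.hom_minus fun_eq_iff)
  qed
  \<comment> \<open>The two scalings are mutually inverse and preserve the ratios of the coordinates
    other than \<open>a\<close>. Hence only the term added by \<open>T c\<close> is multiplied, by
    \<open>x_d^2 / x_e^2\<close>.\<close>
  let ?F = "tuple_comp (scale_coord a d e) (tuple_comp (T c) (scale_coord a e d))"
  have "in_G3 ?F"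
    using T assms in_G3_scale_coord in_G3_comp by metis
  moreover have "?F k = mvar d ^ 6 * shear c a b d e k" for k
    using assms
    by (auto simp: comp_simps T_def scale_coord_def shear_def algebra_simps power2_eq_square eval_nat_numeral)
  ultimately show ?thesis
    by (rule in_G3_cancel) (rule homogeneous_shear)
qed

text \<open>The homogenization of \<open>nagata\<close> in degree 5: setting \<open>w = 1\<close>
  recovers the affine formula, see \<open>nagata_P3_affine\<close>.\<close>

definition nagata_P3 :: "'k::field tuple4" where
  "nagata_P3 = (let w = mvar 0; x = mvar 1; y = mvar 2; z = mvar 3; D = x * z - y ^ 2 in
     (\<lambda>_. 0)(0 := w ^ 5, 1 := x * w ^ 4 + 2 * y * D * w ^ 2 + z * D ^ 2,
       2 := y * w ^ 4 + z * D * w ^ 2, 3 := z * w ^ 4))"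

lemma homogeneous_2: "n = 0 \<Longrightarrow> homogeneous n 2"
  by (metis homogeneous_1 homogeneous_add one_add_one)

lemma homogeneous_nagata_P3: "homogeneous 5 (nagata_P3 i)"
proof -
  have "\<forall>i. homogeneous 5 (nagata_P3 i)"
    unfolding all_4_iff nagata_P3_def
    by (auto simp: Let_def intro!: homogeneous_intros homogeneous_2)
  then show ?thesis by blast
qed

text \<open>
  The function \<open>u = x - y\<^sup>2 / z\<close> is invariant under the Nagata automorphism, and in the coordinates
  \<open>u, y, z\<close> the automorphism is \<open>y \<mapsto> y + z\<^sup>2 u\<close>.
\<close>

lemma in_G3_nagata_P3: "in_G3 (nagata_P3 :: 'k::field tuple4)"
proof -
  define w x y z :: "(4, 'k) mpoly" where v: "w = mvar 0" "x = mvar 1" "y = mvar 2" "z = mvar 3"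
  have hom: "homogeneous n w" "homogeneous n x" "homogeneous n y" "homogeneous n z" if "n = 1" for n
    unfolding v that by (rule homogeneous_mvar)+
  \<comment> \<open>The map \<open>x \<mapsto> x - y^2/z\<close> followed by
    \<open>y \<mapsto> y + x z^2/w^2\<close>, after division by \<open>z ^ 5\<close>.\<close>
  define C :: "'k tuple4" where
    "C = (\<lambda>_. 0)(0 := w ^ 3 * z, 1 := (x * z - y ^ 2) * w ^ 2,
       2 := y * w ^ 2 * z + (x * z - y ^ 2) * z ^ 2, 3 := z ^ 2 * w ^ 2)"
  have "in_G3 (tuple_comp (shear 1 2 1 3 0) (shear (- 1) 1 3 2 3) :: 'k tuple4)"
    by (intro in_G3_comp in_G3_shear) simp_all
  then have "in_G3 C"
  proof (rule in_G3_cancel)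
    have "\<forall>k. tuple_comp (shear 1 2 1 3 0) (shear (- 1) 1 3 2 3) k = z ^ 5 * C k"
      unfolding all_4_iff comp_shear
      by (simp add: shear_def C_def mconst.hom_simps v[symmetric]) (simp add: algebra_simps eval_nat_numeral)
    then show "tuple_comp (shear 1 2 1 3 0) (shear (- 1) 1 3 2 3) k = z ^ 5 * C k" for k
      by blast
    have "\<forall>k. homogeneous 4 (C k)"
      unfolding all_4_iff by (auto simp: C_def intro!: homogeneous_intros hom)
    then show "homogeneous 4 (C k)" for k
      by blast
  qed
  \<comment> \<open>The last shear adds \<open>y^2/z\<close>, with the new \<open>y\<close>, back to
    the coordinate \<open>x\<close>.\<close>
  then have "in_G3 (tuple_comp (shear 1 1 3 2 3) C)"
    by (intro in_G3_comp in_G3_shear) simp_all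
  then show ?thesis
  proof (rule in_G3_cancel)
    have "\<forall>k. tuple_comp (shear 1 1 3 2 3) C k = z ^ 5 * w ^ 2 * nagata_P3 k"
      unfolding all_4_iff comp_shear
      by (simp add: C_def nagata_P3_def Let_def mconst.hom_simps v[symmetric]) (simp add: algebra_simps eval_nat_numeral)
    then show "tuple_comp (shear 1 1 3 2 3) C k = z ^ 5 * w ^ 2 * nagata_P3 k" for k
      by blast
  qed (rule homogeneous_nagata_P3)
qed

section \<open>Linear embeddings\<close>

text \<open>Over an arbitrary ring, this serves both as the tuple of polynomials
  \<open>affine_chart mvar\<close> and as the image of a point.\<close>

definition affine_chart :: "(3 \<Rightarrow> 'r::comm_ring_1) \<Rightarrow> 4 \<Rightarrow> 'r" where
  "affine_chart p = (\<lambda>_. 0)(0 := 1, 1 := p 0, 2 := p 1, 3 := p 2)"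

lemma comp_affine_chart: "tuple_comp (affine_chart mvar) f = affine_chart f"
  by (rule tuple4_eqI) (simp_all add: comp_simps affine_chart_def)

text \<open>Dehomogenization loses only the exponent of \<open>x_0\<close>, which the degree and the
  other exponents determine. So distinct monomials of a form stay distinct.\<close>

lemma affine_chart_injective:
  fixes p :: "(4, 'k::field) mpoly"
  assumes hom: "homogeneous d p" and zero: "mp_eval mconst (affine_chart mvar) p = 0"
  shows "p = 0"
proof -
  define r :: "(4 \<Rightarrow>\<^sub>0 nat) \<Rightarrow> (3 \<Rightarrow>\<^sub>0 nat)" where
    "r m = Poly_Mapping.single 0 (Poly_Mapping.lookup m 1) + Poly_Mapping.single 1 (Poly_Mapping.lookup m 2)
      + Poly_Mapping.single 2 (Poly_Mapping.lookup m 3)" for m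
  have r: "Poly_Mapping.lookup (r m) 0 = Poly_Mapping.lookup m 1"
    "Poly_Mapping.lookup (r m) 1 = Poly_Mapping.lookup m 2"
    "Poly_Mapping.lookup (r m) 2 = Poly_Mapping.lookup m 3" for m
    by (simp_all add: r_def lookup_add lookup_single)
  have inj: "m = n" if "m \<in> Poly_Mapping.keys p" "n \<in> Poly_Mapping.keys p" "r m = r n" for m n
  proof -
    have "Poly_Mapping.lookup m 1 = Poly_Mapping.lookup n 1"
      "Poly_Mapping.lookup m 2 = Poly_Mapping.lookup n 2"
      "Poly_Mapping.lookup m 3 = Poly_Mapping.lookup n 3"
      using r[of m] r[of n] that(3) by simp_all
    moreover have "mono_degree m = mono_degree n"
      using hom that by (simp add: homogeneous_def)
    ultimately have "Poly_Mapping.lookup m = Poly_Mapping.lookup n"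
      by (intro tuple4_eqI) (simp_all add: mono_degree_def sum_UNIV_4)
    then show "m = n"
      by (simp only: poly_mapping_eq_iff)
  qed
  have pow: "mvar i ^ n = Poly_Mapping.single (Poly_Mapping.single i n) (1 :: 'k)" for i :: 3 and n
    by (induction n) (simp_all add: mvar_def mult_single flip: single_add)
  have "mconst c * (\<Prod>i\<in>UNIV. affine_chart mvar i ^ Poly_Mapping.lookup m i) = Poly_Mapping.single (r m) c"
    for m and c :: 'k
    by (simp add: prod_UNIV_4 affine_chart_def pow mult_single mconst_def r_def add.assoc)
  then have eval: "mp_eval mconst (affine_chart mvar) p
      = (\<Sum>m\<in>Poly_Mapping.keys p. Poly_Mapping.single (r m) (Poly_Mapping.lookup p m))"
    by (simp add: mp_eval_def)
  have "Poly_Mapping.lookup p n = 0" if n: "n \<in> Poly_Mapping.keys p" for n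
  proof -
    have "Poly_Mapping.lookup (mp_eval mconst (affine_chart mvar) p) (r n)
        = (\<Sum>m\<in>Poly_Mapping.keys p. if m = n then Poly_Mapping.lookup p n else 0)"
      unfolding eval lookup_sum using inj n
      by (intro sum.cong) (auto simp: lookup_single when_def)
    then show ?thesis
      using zero n by simp
  qed
  then show ?thesis
    by (metis in_keys_iff lookup_zero poly_mapping_eqI)
qed

section \<open>Polynomials of degree at most one\<close>

lemma mono_degree_eq_0_iff: "mono_degree m = 0 \<longleftrightarrow> m = 0"
proof
  assume "mono_degree m = 0"
  then show "m = 0"
    by (intro poly_mapping_eqI) (simp add: mono_degree_def)
qed (simp add: mono_degree_def)

lemma mono_degree_eq_1_iff: "mono_degree m = 1 \<longleftrightarrow> (\<exists>j. m = Poly_Mapping.single j 1)"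
proof
  assume "mono_degree m = 1"
  then obtain j where j: "Poly_Mapping.lookup m j = 1" "\<And>i. j \<noteq> i \<Longrightarrow> Poly_Mapping.lookup m i = 0"
    unfolding mono_degree_def sum_eq_1_iff[OF finite_class.finite_UNIV] by blast
  then have "m = Poly_Mapping.single j 1"
    by (intro poly_mapping_eqI) (auto simp: lookup_single when_def)
  then show "\<exists>j. m = Poly_Mapping.single j 1" ..
qed (auto simp: mono_degree_def lookup_single when_def)

lemma affine_linear_expansion:
  fixes p :: "('i::finite, 'k::comm_ring_1) mpoly"
  assumes "\<And>m. mono_degree m \<ge> 2 \<Longrightarrow> Poly_Mapping.lookup p m = 0"
  shows "p = mconst (Poly_Mapping.lookup p 0)
    + (\<Sum>j\<in>UNIV. mconst (Poly_Mapping.lookup p (Poly_Mapping.single j 1)) * mvar j)"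
proof (rule poly_mapping_eqI)
  fix m :: "'i \<Rightarrow>\<^sub>0 nat"
  have mult: "mconst c * mvar j = Poly_Mapping.single (Poly_Mapping.single j 1) c" for c :: 'k and j :: 'i
    by (simp add: mconst_def mvar_def mult_single)
  have inj: "Poly_Mapping.single i (Suc 0) = Poly_Mapping.single j (Suc 0) \<longleftrightarrow> i = j" for i j :: 'i
    by (metis keys_single singleton_inject One_nat_def one_neq_zero)
  have neq: "Poly_Mapping.single j (Suc 0) \<noteq> 0" for j :: 'i
    by (metis keys_single keys_zero insert_not_empty One_nat_def one_neq_zero)
  consider "m = 0" | j where "m = Poly_Mapping.single j 1" | "mono_degree m \<ge> 2"
    using mono_degree_eq_0_iff[of m] mono_degree_eq_1_iff[of m] less_2_cases[of "mono_degree m"]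
    by (metis One_nat_def not_le)
  then show "Poly_Mapping.lookup p m = Poly_Mapping.lookup (mconst (Poly_Mapping.lookup p 0)
    + (\<Sum>j\<in>UNIV. mconst (Poly_Mapping.lookup p (Poly_Mapping.single j 1)) * mvar j)) m"
  proof cases
    case 3
    then have "m \<noteq> 0" "Poly_Mapping.single j 1 \<noteq> m" for j
      using mono_degree_eq_0_iff[of m] mono_degree_eq_1_iff[of m] by auto
    then show ?thesis
      using assms[OF 3] unfolding mult
      by (simp add: lookup_add lookup_sum mconst_def lookup_single when_def)
  qed (unfold mult, simp_all add: lookup_add lookup_sum mconst_def lookup_single when_def inj neq neq[symmetric])
qed

section \<open>Varying a general hyperplane\<close>

lemma infinite_alg_closed: "infinite (UNIV :: 'a::alg_closed_field set)"
proof
  assume fin: "finite (UNIV :: 'a set)"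
  \<comment> \<open>As in Euclid's argument, \<open>P\<close> vanishes everywhere, so the
    nonconstant \<open>P + 1\<close> would have no root.\<close>
  define P :: "'a poly" where "P = (\<Prod>a\<in>UNIV. [:- a, 1:])"
  have "degree P = card (UNIV :: 'a set)"
    unfolding P_def by (subst degree_prod_eq_sum_degree) simp_all
  then have "degree P > 0"
    using fin by (simp add: finite_UNIV_card_ge_0)
  then have "degree (P + 1) > 0"
    by (simp add: degree_add_eq_left)
  then obtain a where "poly (P + 1) a = 0"
    using alg_closed_imp_poly_has_root by blast
  moreover have "poly P a = 0"
    using fin by (auto simp: P_def poly_prod)
  ultimately show False
    by simp
qed

text \<open>With univariate polynomials \<open>v i\<close>, this restricts \<open>p\<close> to a
  parametrized curve and makes the finiteness of roots available.\<close>

lemma poly_mp_eval: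
  "poly (mp_eval (\<lambda>c. [:h c:]) v p) t = mp_eval h (\<lambda>i. poly (v i) t) p"
  by (simp add: mp_eval_def poly_sum poly_prod)

text \<open>A form that is nonzero at \<open>a\<close> restricts to a nonzero polynomial on the line
  through \<open>a\<close> in direction \<open>i\<close>. It has finitely many roots, while the
  field is infinite.\<close>

lemma open_P3_perturb:
  fixes a :: "4 \<Rightarrow> 'k::field alg_closure"
  assumes "open_P3 V" "a \<in> V"
  obtains t where "t \<noteq> 0" "a(i := a i + t) \<in> V"
proof -
  obtain S where V: "V = {p. p \<noteq> (\<lambda>_. 0) \<and> (\<exists>g\<in>S. eval_ac p (g :: (4, 'k) mpoly) \<noteq> 0)}"
    using assms(1) unfolding open_P3_def by blast
  then obtain g where g: "g \<in> S" "eval_ac a g \<noteq> 0"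
    using assms(2) by blast
  define q where "q = mp_eval (\<lambda>c. [:to_ac c:]) (\<lambda>j. if j = i then [:a i, 1:] else [:a j:]) g"
  have q: "poly q t = eval_ac (a(i := a i + t)) g" for t
    unfolding q_def poly_mp_eval by (rule arg_cong[where f = "\<lambda>v. eval_ac v g"]) auto
  have "poly q 0 \<noteq> 0"
    using g(2) by (simp add: q)
  then have "q \<noteq> 0"
    by auto
  \<comment> \<open>Avoiding 0 makes the shift proper. Avoiding \<open>- a i\<close> keeps
    coordinate \<open>i\<close> nonzero, so the new vector is not zero.\<close>
  then have "finite ({t. poly q t = 0} \<union> {0, - a i})"
    by (simp add: poly_roots_finite)
  then obtain t where "t \<notin> {t. poly q t = 0} \<union> {0, - a i}"
    using ex_new_if_finite[OF infinite_alg_closed] by metis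
  then have t: "poly q t \<noteq> 0" "t \<noteq> 0" "t \<noteq> - a i"
    by auto
  then have "(a(i := a i + t)) i \<noteq> 0"
    by (metis add.commute eq_neg_iff_add_eq_0 fun_upd_same)
  then have "a(i := a i + t) \<noteq> (\<lambda>_. 0)"
    by (metis)
  then have "a(i := a i + t) \<in> V"
    using t(1) g(1) unfolding V q by blast
  with t(2) show ?thesis
    by (rule that)
qed

text \<open>The coefficient of the pull-back at \<open>m\<close> is linear in the coefficients of
  the hyperplane and vanishes on \<open>V\<close>. Changing only \<open>a i\<close> within
  \<open>V\<close> isolates the contribution of \<open>\<tau> i\<close>.\<close>

lemma linear_embedding_degree:
  fixes \<tau> :: "4 \<Rightarrow> (3, 'k::field) mpoly"
  assumes \<tau>: "linear_embedding \<tau>" and m: "mono_degree m \<ge> 2"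
  shows "Poly_Mapping.lookup (\<tau> i) m = 0"
proof -
  obtain V a where V: "open_P3 V" "\<And>a. a \<in> V \<Longrightarrow> total_degree (pullback_hyperplane \<tau> a) = 1" and a: "a \<in> V"
    using \<tau> unfolding linear_embedding_def by blast
  have zero: "(\<Sum>j\<in>UNIV. b j * to_ac (Poly_Mapping.lookup (\<tau> j) m)) = 0" if "b \<in> V" for b
  proof -
    let ?P = "pullback_hyperplane \<tau> b"
    have "m \<notin> Poly_Mapping.keys ?P"
    proof
      assume "m \<in> Poly_Mapping.keys ?P"
      then have "mono_degree m \<le> total_degree ?P"
        unfolding total_degree_def by (intro Max_ge) auto
      then show False
        using V(2)[OF that] m by simp
    qed
    then have "Poly_Mapping.lookup ?P m = 0"
      by (simp add: in_keys_iff)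
    moreover have "Poly_Mapping.lookup (Poly_Mapping.map (\<lambda>c. b j * to_ac c) (\<tau> j)) m
        = b j * to_ac (Poly_Mapping.lookup (\<tau> j) m)" for j
      by (simp add: Poly_Mapping.map.rep_eq when_def)
    ultimately show ?thesis
      by (simp add: pullback_hyperplane_def lookup_sum)
  qed
  obtain t where t: "t \<noteq> 0" "a(i := a i + t) \<in> V"
    using open_P3_perturb[OF V(1) a] .
  have "(\<Sum>j\<in>UNIV. (a(i := a i + t)) j * to_ac (Poly_Mapping.lookup (\<tau> j) m))
      = (\<Sum>j\<in>UNIV. a j * to_ac (Poly_Mapping.lookup (\<tau> j) m)
          + (if j = i then t * to_ac (Poly_Mapping.lookup (\<tau> i) m) else 0))"
    by (intro sum.cong) (auto simp: algebra_simps)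
  then have "t * to_ac (Poly_Mapping.lookup (\<tau> i) m) = 0"
    using zero[OF a] zero[OF t(2)] by (simp add: sum.distrib)
  then show ?thesis
    using t(1) by simp
qed

section \<open>Linear tuples and invertible matrices\<close>

no_notation fps_nth (infixl "$" 75)

definition linear_tuple :: "'k::field ^ 4 ^ 4 \<Rightarrow> 'k tuple4" where
  "linear_tuple A = (\<lambda>i. \<Sum>j\<in>UNIV. mconst (A $ i $ j) * mvar j)"

lemma homogeneous_linear_tuple: "homogeneous 1 (linear_tuple A i)"
  by (auto simp: linear_tuple_def intro!: homogeneous_sum homogeneous_intros)

lemma linear_tuple_mat_1: "linear_tuple (mat 1) = mvar"
proof
  fix i
  have "linear_tuple (mat 1) i = (\<Sum>j\<in>UNIV. if i = j then mvar j else 0)"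
    unfolding linear_tuple_def by (intro sum.cong) (auto simp: mat_def mconst.hom_simps)
  then show "linear_tuple (mat 1) i = mvar i"
    by simp
qed

lemma linear_tuple_comp: "tuple_comp (linear_tuple A) (linear_tuple B) = linear_tuple (A ** B)"
proof
  fix i
  have "tuple_comp (linear_tuple A) (linear_tuple B) i
      = (\<Sum>j\<in>UNIV. \<Sum>k\<in>UNIV. mconst (A $ i $ j) * (mconst (B $ j $ k) * mvar k))"
    by (simp add: comp_simps linear_tuple_def sum_distrib_left)
  also have "\<dots> = (\<Sum>k\<in>UNIV. \<Sum>j\<in>UNIV. mconst (A $ i $ j) * (mconst (B $ j $ k) * mvar k))"
    by (rule sum.swap)
  also have "\<dots> = linear_tuple (A ** B) i"
    by (simp add: linear_tuple_def matrix_matrix_mult_def mconst.hom_simps sum_distrib_right mult.assoc)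
  finally show "tuple_comp (linear_tuple A) (linear_tuple B) i = linear_tuple (A ** B) i" .
qed

text \<open>As \<tau> has degree at most one, it is a matrix \<open>A\<close> applied to the chart.
  A kernel vector with \<open>x_0\<close> nonzero would give a point where all
  \<open>\<tau> i\<close> vanish, one with \<open>x_0 = 0\<close> a direction along which \<tau> is
  constant. An embedding excludes the first and allows only the zero vector in the second case, so
  \<open>A\<close> is invertible.\<close>

lemma linear_embedding_cases:
  fixes \<tau> :: "4 \<Rightarrow> (3, 'k::field) mpoly"
  assumes \<tau>: "linear_embedding \<tau>"
  obtains F G where "\<And>i. homogeneous 1 (F i)" "\<And>i. homogeneous 1 (G i)"
    "tuple_comp F G = mvar" "tuple_comp G F = mvar" "\<tau> = tuple_comp F (affine_chart mvar)"
proof -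
  \<comment> \<open>Column 0 holds the constant terms. In the other columns
    \<open>affine_chart\<close> only shifts the index of the linear coefficients.\<close>
  define A :: "'k ^ 4 ^ 4" where
    "A = (\<chi> i j. if j = 0 then Poly_Mapping.lookup (\<tau> i) 0
      else affine_chart (\<lambda>k. Poly_Mapping.lookup (\<tau> i) (Poly_Mapping.single k 1)) j)"
  have \<tau>_eq: "\<tau> = tuple_comp (linear_tuple A) (affine_chart mvar)"
  proof
    fix i
    have "\<tau> i = mconst (Poly_Mapping.lookup (\<tau> i) 0)
      + (\<Sum>j\<in>UNIV. mconst (Poly_Mapping.lookup (\<tau> i) (Poly_Mapping.single j 1)) * mvar j)"
      by (rule affine_linear_expansion) (rule linear_embedding_degree[OF \<tau>])
    also have "\<dots> = (\<Sum>j\<in>UNIV. mconst (A $ i $ j) * affine_chart mvar j)"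
      unfolding sum_UNIV_4 sum_UNIV_3 A_def by (simp add: affine_chart_def add.assoc)
    also have "\<dots> = tuple_comp (linear_tuple A) (affine_chart mvar) i"
      by (simp add: comp_simps linear_tuple_def)
    finally show "\<tau> i = tuple_comp (linear_tuple A) (affine_chart mvar) i" .
  qed
  have eval: "eval_ac p (\<tau> i) = (\<Sum>j\<in>UNIV. to_ac (A $ i $ j) * affine_chart p j)" for p i
  proof -
    have chart: "(\<lambda>i. eval_ac p (affine_chart mvar i)) = affine_chart p"
      by (rule tuple4_eqI) (simp_all add: affine_chart_def eval_ac.hom_simps to_ac.mp_eval_mvar)
    have "eval_ac p (\<tau> i) = eval_ac (affine_chart p) (linear_tuple A i)"
      by (subst \<tau>_eq) (simp add: tuple_comp_def mp_eval_subst[OF cring_hom_to_ac] chart)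
    also have "\<dots> = (\<Sum>j\<in>UNIV. to_ac (A $ i $ j) * affine_chart p j)"
      unfolding linear_tuple_def eval_ac.hom_simps to_ac.mp_eval_mvar to_ac.mp_eval_mconst ..
    finally show ?thesis .
  qed
  have "open_embedding \<tau>"
    using \<tau> unfolding linear_embedding_def by blast
  then obtain \<rho> where nonzero: "\<And>p. \<exists>i. eval_ac p (\<tau> i) \<noteq> 0"
    and \<rho>: "\<And>p j. \<rho> j (\<lambda>i. eval_ac p (\<tau> i)) = p j"
    unfolding open_embedding_def affine_morphism_def by metis
  have "x = 0" if x: "A *v x = 0" for x
  proof -
    have Ax: "(\<Sum>j\<in>UNIV. A $ i $ j * x $ j) = 0" for i
      using x by (simp add: matrix_vector_mult_def vec_eq_iff)
    have "x $ 0 = 0"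
    proof (rule ccontr)
      assume x0: "x $ 0 \<noteq> 0"
      define p :: "3 \<Rightarrow> 'k alg_closure" where
        "p = (\<lambda>_. 0)(0 := to_ac (x $ 1 / x $ 0), 1 := to_ac (x $ 2 / x $ 0), 2 := to_ac (x $ 3 / x $ 0))"
      have chart: "affine_chart p = (\<lambda>j. to_ac (x $ j / x $ 0))"
        by (rule tuple4_eqI) (use x0 in \<open>simp_all add: affine_chart_def p_def\<close>)
      have "eval_ac p (\<tau> i) = to_ac ((\<Sum>j\<in>UNIV. A $ i $ j * x $ j) / x $ 0)" for i
        unfolding eval chart by (simp only: to_ac_sum sum_divide_distrib to_ac_mult times_divide_eq_right flip: to_ac_mult)
      then show False
        using nonzero[of p] Ax by simp
    qed
    \<comment> \<open>This point and the origin differ by a kernel vector, so they have the same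
      image, and the left inverse \<open>\<rho>\<close> identifies them.\<close>
    define p :: "3 \<Rightarrow> 'k alg_closure" where
      "p = (\<lambda>_. 0)(0 := to_ac (x $ 1), 1 := to_ac (x $ 2), 2 := to_ac (x $ 3))"
    have chart: "affine_chart p j = to_ac (x $ j) + affine_chart (\<lambda>_. 0) j" for j
    proof -
      have "affine_chart p = (\<lambda>j. to_ac (x $ j) + affine_chart (\<lambda>_. 0) j)"
        by (rule tuple4_eqI) (simp_all add: affine_chart_def p_def \<open>x $ 0 = 0\<close>)
      then show ?thesis by simp
    qed
    have "eval_ac p (\<tau> i) = to_ac (\<Sum>j\<in>UNIV. A $ i $ j * x $ j) + eval_ac (\<lambda>_. 0) (\<tau> i)" for i
      unfolding eval chart by (simp add: ring_distribs sum.distrib to_ac_sum)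
    then have "(\<lambda>i. eval_ac p (\<tau> i)) = (\<lambda>i. eval_ac (\<lambda>_. 0) (\<tau> i))"
      by (simp add: Ax)
    then have p: "p j = 0" for j
      using \<rho> by metis
    have "(\<lambda>j. x $ j) = (\<lambda>_. 0)"
      using p[of 0] p[of 1] p[of 2] by (intro tuple4_eqI) (simp_all add: p_def \<open>x $ 0 = 0\<close>)
    then show "x = 0"
      by (simp add: vec_eq_iff fun_eq_iff)
  qed
  then obtain B where B: "B ** A = mat 1"
    using matrix_left_invertible_ker[of A] by blast
  then have "A ** B = mat 1"
    by (simp add: matrix_left_right_inverse)
  with B \<tau>_eq show ?thesis
    using that[of "linear_tuple A" "linear_tuple B"] homogeneous_linear_tuple linear_tuple_comp linear_tuple_mat_1
    by metis
qed

lemma nagata_P3_affine: "tuple_comp nagata_P3 (affine_chart mvar) = affine_chart nagata"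
  by (rule tuple4_eqI) (simp_all add: comp_simps nagata_P3_def nagata_def affine_chart_def Let_def)

theorem proposition6p8:
  fixes \<tau> :: "4 \<Rightarrow> (3, 'k::field) mpoly"
  assumes "CHAR('k) \<noteq> 2"
    and "linear_embedding \<tau>"
  shows "conj_by_embedding \<tau> nagata \<in> G3"
proof -
  let ?e = "affine_chart mvar :: 4 \<Rightarrow> (3, 'k) mpoly"
  obtain F G where hom: "\<And>i. homogeneous 1 (F i)" "\<And>i. homogeneous 1 (G i)"
    and FG: "tuple_comp F G = mvar" "tuple_comp G F = mvar" and \<tau>: "\<tau> = tuple_comp F ?e"
    using linear_embedding_cases[OF assms(2)] by blast
  \<comment> \<open>Since \<open>G\<close> undoes \<open>F\<close>, this tuple acts on the image of
    \<tau> as the Nagata automorphism.\<close>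
  define Q where "Q = tuple_comp F (tuple_comp nagata_P3 G)"
  have F: "in_G3 F" and G: "in_G3 G"
    using linear_in_G3 hom FG by blast+
  have Q: "in_G3 Q"
    unfolding Q_def by (intro in_G3_comp F G in_G3_nagata_P3)
  have "tuple_comp Q \<tau> = tuple_comp F (tuple_comp nagata_P3 (tuple_comp (tuple_comp G F) ?e))"
    unfolding Q_def \<tau> tuple_comp_assoc ..
  also have "\<dots> = tuple_comp \<tau> nagata"
    by (simp add: FG nagata_P3_affine \<tau> tuple_comp_assoc comp_affine_chart)
  finally have Q\<tau>: "tuple_comp \<tau> nagata = tuple_comp Q \<tau>" ..
  \<comment> \<open>The image of \<tau> is dense: pulling a form back along the dominant
    \<open>F\<close> and then along the chart loses nothing.\<close>
  have zero: "p = 0" if "homogeneous d p" "mp_eval mconst \<tau> p = 0" for d p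
  proof -
    have "mp_eval mconst ?e (mp_eval mconst F p) = 0"
      using that(2) unfolding \<tau> tuple_comp_def by (simp add: mp_eval_subst[OF mconst.cring_hom_axioms])
    then have "mp_eval mconst F p = 0"
      by (rule affine_chart_injective[OF homogeneous_subst[OF that(1) hom(1)]])
    then show ?thesis
      using that(1) birational_dominant F unfolding in_G3_def dominant_def by blast
  qed
  have Qrat: "rational_tuple Q"
    using Q birational_rational unfolding in_G3_def by blast
  have "F' \<in> conj_by_embedding \<tau> nagata \<longleftrightarrow> F' \<in> rat_class Q" for F'
  proof (cases "rational_tuple F'")
    case True
    then obtain d k where F': "\<And>i. homogeneous d (F' i)" "F' k \<noteq> 0"
      unfolding rational_tuple_def by blast
    obtain e where Q': "\<And>i. homogeneous e (Q i)"
      using Qrat unfolding rational_tuple_def by blast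
    have "tuple_comp F' \<tau> k \<noteq> 0"
      using zero F' unfolding tuple_comp_def by blast
    moreover have "proportional (tuple_comp F' \<tau>) (tuple_comp Q \<tau>) \<longleftrightarrow> proportional F' Q"
    proof
      assume FQ: "proportional (tuple_comp F' \<tau>) (tuple_comp Q \<tau>)"
      \<comment> \<open>The cross products are forms, so \<open>zero\<close> lifts their vanishing
        from affine to projective space.\<close>
      have "F' i * Q j - F' j * Q i = 0" for i j
      proof (rule zero)
        show "homogeneous (d + e) (F' i * Q j - F' j * Q i)"
          by (intro homogeneous_diff homogeneous_mult F' Q')
        show "mp_eval mconst \<tau> (F' i * Q j - F' j * Q i) = 0"
          using FQ by (simp add: subst.hom_simps proportional_def tuple_comp_def)
      qed
      then show "proportional F' Q"
        by (simp add: proportional_def)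
    qed (rule proportional_comp_left)
    ultimately show ?thesis
      using True proportional_sym[of F' Q] proportional_sym[of Q F']
      unfolding conj_by_embedding_def rat_class_def Q\<tau> by blast
  qed (auto simp: conj_by_embedding_def rat_class_def)
  then have "conj_by_embedding \<tau> nagata = rat_class Q"
    by blast
  with Q show ?thesis
    unfolding in_G3_def by simp
qed

end
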